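(* If $\mathbf C$ is a selective monoidal category (respectively, a selective rigid monoidal category), then $\mathrm{WW}(\mathbf C)$, with the structure described in the context, is a monoidal category (respectively, a rigid monoidal category). If $\mathbf C$ is, in addition, highly selective (that is, a highly selective monoidal category, respectively a highly selective rigid monoidal category), then $\mathrm{WW}(\mathbf C)$ contains distinguished monoidal subcategories of reductions and coreductions, namely the images of the reductions and coreductions of $\mathbf C$ under the map sending a suave morphism $f$ to $[f]$.
   Context: Morphisms are written from right to left: $X\leftarrow Y$ is a morphism to $X$ from $Y$, and $(f,g)$ is composable, with composition $fg$, when $X\stackrel{f}{\leftarrow}Y\stackrel{g}{\leftarrow}Z$. A selective category is a category together with a distinguished class of morphisms, called suave, and a class of composable pairs of suave morphisms, called congenial pairs, such that: (1) every identity morphism is suave; (2) if $f$ and $g$ are suave, $(f,g)$ is composable, and $f$ or $g$ is an identity morphism, then $(f,g)$ is congenial; (3) if $(f,g)$ is congenial, then $fg$ is suave; (4) if $f$ is a suave isomorphism, then $f^{-1}$ is suave, and $(f,f^{-1})$ and $(f^{-1},f)$ are both congenial; (5) if $(f,g,h)$ is a composable triple, then $(f,g)$ and $(fg,h)$ are congenial if and only if $(g,h)$ and $(f,gh)$ are. A functor between selective categories is selective if it takes congenial pairs to congenial pairs. A highly selective category is a selective category provided with two subcategories of suave morphisms, called reductions and coreductions, such that: (1) any suave isomorphism is both a coreduction and a reduction; (2) if $(f,g)$ is a composable pair of suave morphisms, and $f$ is a coreduction or $g$ is a reduction, then $(f,g)$ is congenial; (3) any suave morphism $f$ may be factored as $gh$,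 where $g$ is a reduction, $h$ is a coreduction, and $(g,h)$ is congenial. Monoidal structures ($\otimes$, unit object $\mathbf 1$) are taken to be strict. A monoidal structure is left rigid if each object $X$ is assigned a left dual $\overline X$ with unit $X\otimes\overline X\stackrel{\delta_X}{\longleftarrow}\mathbf 1$ and counit $\mathbf 1\stackrel{\epsilon_X}{\longleftarrow}\overline X\otimes X$ such that $(1_X\otimes\epsilon_X)(\delta_X\otimes 1_X)=1_X$ and $(\epsilon_X\otimes 1_{\overline X})(1_{\overline X}\otimes\delta_X)=1_{\overline X}$; right rigidity is analogous, and rigid means both. Duality extends to a contravariant functor $f\mapsto\overline f$; $\overline{\overline X}$ is identified with $X$ (so $\delta_{\overline X}$ is a morphism $\overline X\otimes X\leftarrow\mathbf 1$) and $\overline{X\otimes Y}$ with $\overline Y\otimes\overline X$. A selective monoidal category is a monoidal category with a selective structure such that the classes of suave morphisms and of congenial pairs are closed under the monoidal product. If it is also highly selective and the subcategories of reductions and coreductions are closed under the monoidal product, it is a highly selective monoidal category. A selective rigid monoidal category is a selective monoidal category equipped with a rigid structure such that: (1) the unit and counit morphisms are suave; (2) the duality functor is selective; (3) if $X\stackrel{f}{\leftarrow}Y\otimes Z$ is suave, then the compositions $(f\otimes 1_{\overline Z})(1_Y\otimes\delta_Z)$ and $(1_{\overline Y}\otimes f)(\delta_{\overline Y}\otimes 1_Z)$ are both congenial. If it is also highly selective, it is a highly selective rigid monoidal category if the unit and counit morphisms are coreductions and reductions respectively, and the duality functor exchanges reductions and coreductions. Wehrheim–Woodward category. A path in $\mathbf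 C$ is a composable sequence $(\ldots,f_{-1},f_0,f_1,\ldots)$ of morphisms indexed by the integers, only finitely many of which are not identity morphisms; its target (source) is the object whose identity appears for all large negative (positive) indices. Two paths are equivalent if one is obtained from the other by inserting and removing finitely many identity morphisms. Equivalence classes of paths of suave morphisms are the morphisms of a category $P_s(\mathbf C)$ with the objects of $\mathbf C$, composition being concatenation (after truncating the identities at the ends being joined). $\mathrm{WW}(\mathbf C)$ is the quotient category of $P_s(\mathbf C)$ by the smallest equivalence relation for which two paths are equivalent whenever a sequence representing one is obtained from a sequence representing the other by replacing successive entries forming a congenial pair $(p,q)$ by the composition $pq$ preceded or followed by an identity morphism. The class of a sequence $f$ is denoted $[f]$; for a single suave morphism $f$, $[f]$ is the class of the sequence with one entry $f$ and all others identities. Structure on $\mathrm{WW}(\mathbf C)$: the monoidal product on objects and the unit object are those of $\mathbf C$; the monoidal product of two morphisms is represented by the entry-by-entry monoidal product $(f_i\otimes f'_i)_i$ of representative (bi-infinite) sequences; in the rigid case, the dual of an object is its dual in $\mathbf C$, and the unit and counit morphisms are $[\delta_X]$ and $[\epsilon_X]$. *)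

theory Defs
  imports Main
begin

section \<open>Categories\<close>

text \<open>
  Morphisms are read from right to left: \<open>f \<cdot> g\<close> is defined when the source of \<open>f\<close> is the
  target of \<open>g\<close>.
\<close>

record ('o, 'm) cat =
  Obj :: "'o set"
  Mor :: "'m set"
  Tgt :: "'m \<Rightarrow> 'o"
  Src :: "'m \<Rightarrow> 'o"
  Idn :: "'o \<Rightarrow> 'm"
  Cmp :: "'m \<Rightarrow> 'm \<Rightarrow> 'm" (infixl "\<cdot>\<index>" 70)

definition composable :: "('o, 'm, 'z) cat_scheme \<Rightarrow> 'm \<Rightarrow> 'm \<Rightarrow> bool" where
  "composable C f g \<longleftrightarrow> f \<in> Mor C \<and> g \<in> Mor C \<and> Src C f = Tgt C g"

locale category =
  fixes C :: "('o, 'm, 'z) cat_scheme" (structure)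
  assumes Tgt_closed: "f \<in> Mor C \<Longrightarrow> Tgt C f \<in> Obj C"
    and Src_closed: "f \<in> Mor C \<Longrightarrow> Src C f \<in> Obj C"
    and Idn_closed: "X \<in> Obj C \<Longrightarrow> Idn C X \<in> Mor C"
    and Tgt_Idn: "X \<in> Obj C \<Longrightarrow> Tgt C (Idn C X) = X"
    and Src_Idn: "X \<in> Obj C \<Longrightarrow> Src C (Idn C X) = X"
    and Cmp_closed: "composable C f g \<Longrightarrow> f \<cdot> g \<in> Mor C"
    and Tgt_Cmp: "composable C f g \<Longrightarrow> Tgt C (f \<cdot> g) = Tgt C f"
    and Src_Cmp: "composable C f g \<Longrightarrow> Src C (f \<cdot> g) = Src C g"
    and Cmp_assoc: "composable C f g \<Longrightarrow> composable C g h \<Longrightarrow> f \<cdot> g \<cdot> h = f \<cdot> (g \<cdot> h)"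
    and Idn_left: "f \<in> Mor C \<Longrightarrow> Idn C (Tgt C f) \<cdot> f = f"
    and Idn_right: "f \<in> Mor C \<Longrightarrow> f \<cdot> Idn C (Src C f) = f"

definition inverse_in :: "('o, 'm, 'z) cat_scheme \<Rightarrow> 'm \<Rightarrow> 'm \<Rightarrow> bool" where
  "inverse_in C f g \<longleftrightarrow> composable C f g \<and> composable C g f \<and>
     Cmp C f g = Idn C (Tgt C f) \<and> Cmp C g f = Idn C (Src C f)"

definition isomorphism :: "('o, 'm, 'z) cat_scheme \<Rightarrow> 'm \<Rightarrow> bool" where
  "isomorphism C f \<longleftrightarrow> (\<exists>g. inverse_in C f g)"

text \<open>
  A subcategory is given by its set of morphisms and is required to contain all identities.
  For reductions and coreductions this is no restriction, because they contain all suave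
  isomorphisms.
\<close>

definition subcategory :: "('o, 'm, 'z) cat_scheme \<Rightarrow> 'm set \<Rightarrow> bool" where
  "subcategory C M \<longleftrightarrow> M \<subseteq> Mor C \<and> Idn C ` Obj C \<subseteq> M \<and>
     (\<forall>f\<in>M. \<forall>g\<in>M. composable C f g \<longrightarrow> Cmp C f g \<in> M)"

section \<open>Selective and highly selective categories\<close>

locale selective_category = category C for C :: "('o, 'm, 'z) cat_scheme" (structure) +
  fixes suave :: "'m set" and congenial :: "('m \<times> 'm) set"
  assumes suave_Mor: "suave \<subseteq> Mor C"
    and congenialD: "(f, g) \<in> congenial \<Longrightarrow> f \<in> suave \<and> g \<in> suave \<and> composable C f g"
    and Idn_suave: "X \<in> Obj C \<Longrightarrow> Idn C X \<in> suave"
    and Idn_congenial: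
      "\<lbrakk>f \<in> suave; g \<in> suave; composable C f g; f \<in> Idn C ` Obj C \<or> g \<in> Idn C ` Obj C\<rbrakk>
        \<Longrightarrow> (f, g) \<in> congenial"
    and Cmp_suave: "(f, g) \<in> congenial \<Longrightarrow> f \<cdot> g \<in> suave"
    and inverse_suave:
      "\<lbrakk>f \<in> suave; inverse_in C f g\<rbrakk>
        \<Longrightarrow> g \<in> suave \<and> (f, g) \<in> congenial \<and> (g, f) \<in> congenial"
    and congenial_assoc:
      "\<lbrakk>composable C f g; composable C g h\<rbrakk>
        \<Longrightarrow> (f, g) \<in> congenial \<and> (f \<cdot> g, h) \<in> congenial
          \<longleftrightarrow> (g, h) \<in> congenial \<and> (f, g \<cdot> h) \<in> congenial"

locale highly_selective_category = selective_category C suave congenial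
  for C :: "('o, 'm, 'z) cat_scheme" (structure) and suave congenial +
  fixes reductions :: "'m set" and coreductions :: "'m set"
  assumes reductions_suave: "reductions \<subseteq> suave"
    and coreductions_suave: "coreductions \<subseteq> suave"
    and reductions_subcategory: "subcategory C reductions"
    and coreductions_subcategory: "subcategory C coreductions"
    and isomorphism_reduction_coreduction:
      "\<lbrakk>f \<in> suave; isomorphism C f\<rbrakk> \<Longrightarrow> f \<in> coreductions \<and> f \<in> reductions"
    and reduction_coreduction_congenial:
      "\<lbrakk>f \<in> suave; g \<in> suave; composable C f g; f \<in> coreductions \<or> g \<in> reductions\<rbrakk>
        \<Longrightarrow> (f, g) \<in> congenial"
    and factorization:
      "f \<in> suave \<Longrightarrow> \<exists>g\<in>reductions. \<exists>h\<in>coreductions. (g, h) \<in> congenial \<and> f = g \<cdot> h"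

section \<open>Strict monoidal and rigid categories\<close>

record ('o, 'm) mcat = "('o, 'm) cat" +
  TensO :: "'o \<Rightarrow> 'o \<Rightarrow> 'o" (infixl "\<odot>\<index>" 75)
  TensM :: "'m \<Rightarrow> 'm \<Rightarrow> 'm" (infixl "\<otimes>\<index>" 75)
  UnitO :: 'o ("\<one>\<index>")

locale monoidal_category = category C for C :: "('o, 'm, 'z) mcat_scheme" (structure) +
  assumes UnitO_closed: "\<one> \<in> Obj C"
    and TensO_closed: "\<lbrakk>X \<in> Obj C; Y \<in> Obj C\<rbrakk> \<Longrightarrow> X \<odot> Y \<in> Obj C"
    and TensO_assoc:
      "\<lbrakk>X \<in> Obj C; Y \<in> Obj C; Z \<in> Obj C\<rbrakk> \<Longrightarrow> X \<odot> Y \<odot> Z = X \<odot> (Y \<odot> Z)"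
    and TensO_unit: "X \<in> Obj C \<Longrightarrow> \<one> \<odot> X = X \<and> X \<odot> \<one> = X"
    and TensM_closed: "\<lbrakk>f \<in> Mor C; g \<in> Mor C\<rbrakk> \<Longrightarrow> f \<otimes> g \<in> Mor C"
    and Tgt_TensM: "\<lbrakk>f \<in> Mor C; g \<in> Mor C\<rbrakk> \<Longrightarrow> Tgt C (f \<otimes> g) = Tgt C f \<odot> Tgt C g"
    and Src_TensM: "\<lbrakk>f \<in> Mor C; g \<in> Mor C\<rbrakk> \<Longrightarrow> Src C (f \<otimes> g) = Src C f \<odot> Src C g"
    and TensM_Idn:
      "\<lbrakk>X \<in> Obj C; Y \<in> Obj C\<rbrakk> \<Longrightarrow> Idn C X \<otimes> Idn C Y = Idn C (X \<odot> Y)"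
    and TensM_Cmp:
      "\<lbrakk>composable C f g; composable C f' g'\<rbrakk>
        \<Longrightarrow> (f \<cdot> g) \<otimes> (f' \<cdot> g') = (f \<otimes> f') \<cdot> (g \<otimes> g')"
    and TensM_assoc:
      "\<lbrakk>f \<in> Mor C; g \<in> Mor C; h \<in> Mor C\<rbrakk> \<Longrightarrow> f \<otimes> g \<otimes> h = f \<otimes> (g \<otimes> h)"
    and TensM_unit: "f \<in> Mor C \<Longrightarrow> Idn C \<one> \<otimes> f = f \<and> f \<otimes> Idn C \<one> = f"

definition monoidal_subcategory :: "('o, 'm, 'z) mcat_scheme \<Rightarrow> 'm set \<Rightarrow> bool" where
  "monoidal_subcategory C M \<longleftrightarrow> subcategory C M \<and> (\<forall>f\<in>M. \<forall>g\<in>M. TensM C f g \<in> M)"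

record ('o, 'm) rcat = "('o, 'm) mcat" +
  Dual :: "'o \<Rightarrow> 'o"
  Coev :: "'o \<Rightarrow> 'm" ("\<delta>\<index>")
  Ev :: "'o \<Rightarrow> 'm" ("\<epsilon>\<index>")

text \<open>
  \<open>dual_pair C X Y d e\<close>: \<open>Y\<close> is a left dual of \<open>X\<close>, equivalently \<open>X\<close> is a right dual of \<open>Y\<close>,
  with unit \<open>d\<close> and counit \<open>e\<close>.
\<close>

definition dual_pair ::
    "('o, 'm, 'z) mcat_scheme \<Rightarrow> 'o \<Rightarrow> 'o \<Rightarrow> 'm \<Rightarrow> 'm \<Rightarrow> bool" where
  "dual_pair C X Y d e \<longleftrightarrow>
     X \<in> Obj C \<and> Y \<in> Obj C \<and>
     d \<in> Mor C \<and> Tgt C d = X \<odot>\<^bsub>C\<^esub> Y \<and> Src C d = \<one>\<^bsub>C\<^esub> \<and>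
     e \<in> Mor C \<and> Tgt C e = \<one>\<^bsub>C\<^esub> \<and> Src C e = Y \<odot>\<^bsub>C\<^esub> X \<and>
     (Idn C X \<otimes>\<^bsub>C\<^esub> e) \<cdot>\<^bsub>C\<^esub> (d \<otimes>\<^bsub>C\<^esub> Idn C X) = Idn C X \<and>
     (e \<otimes>\<^bsub>C\<^esub> Idn C Y) \<cdot>\<^bsub>C\<^esub> (Idn C Y \<otimes>\<^bsub>C\<^esub> d) = Idn C Y"

text \<open>
  The object \<open>Dual C X\<close> serves both as left and as right dual of \<open>X\<close>. Since the double dual of
  \<open>X\<close> is \<open>X\<close>, its unit and counit as right dual are those of \<open>Dual C X\<close>.
\<close>

locale rigid_category = monoidal_category C for C :: "('o, 'm, 'z) rcat_scheme" (structure) +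
  assumes left_rigid: "X \<in> Obj C \<Longrightarrow> dual_pair C X (Dual C X) (\<delta> X) (\<epsilon> X)"
    and right_rigid:
      "X \<in> Obj C \<Longrightarrow> dual_pair C (Dual C X) X (\<delta> (Dual C X)) (\<epsilon> (Dual C X))"
    and Dual_Dual: "X \<in> Obj C \<Longrightarrow> Dual C (Dual C X) = X"
    and Dual_TensO:
      "\<lbrakk>X \<in> Obj C; Y \<in> Obj C\<rbrakk> \<Longrightarrow> Dual C (X \<odot> Y) = Dual C Y \<odot> Dual C X"

text \<open>
  The duality functor on morphisms: for \<open>f\<close> with target \<open>X\<close> and source \<open>Y\<close>, a morphism to the
  dual of \<open>Y\<close> from the dual of \<open>X\<close>.
\<close>

definition DualM :: "('o, 'm, 'z) rcat_scheme \<Rightarrow> 'm \<Rightarrow> 'm" where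
  "DualM C f =
     (let X = Tgt C f; Y = Src C f; X' = Idn C (Dual C X); Y' = Idn C (Dual C Y)
      in (\<epsilon>\<^bsub>C\<^esub> X \<otimes>\<^bsub>C\<^esub> Y') \<cdot>\<^bsub>C\<^esub> (X' \<otimes>\<^bsub>C\<^esub> f \<otimes>\<^bsub>C\<^esub> Y') \<cdot>\<^bsub>C\<^esub> (X' \<otimes>\<^bsub>C\<^esub> \<delta>\<^bsub>C\<^esub> Y))"

text \<open>
  The locale \<open>rigid_category\<close> identifies double duals and duals of products on objects.
  The identifications are coherent if they are compatible with morphisms, units and counits:
  the double dual of a morphism is the morphism itself, and the canonical isomorphism between
  the dual of \<open>X \<odot> Y\<close> and \<open>Dual C Y \<odot> Dual C X\<close> is the identity.
\<close>

definition coherent_duality :: "('o, 'm, 'z) rcat_scheme \<Rightarrow> bool" where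
  "coherent_duality C \<longleftrightarrow>
     (\<forall>f\<in>Mor C. DualM C (DualM C f) = f) \<and>
     (\<forall>X\<in>Obj C. \<forall>Y\<in>Obj C.
        \<delta>\<^bsub>C\<^esub> (X \<odot>\<^bsub>C\<^esub> Y) =
          (Idn C X \<otimes>\<^bsub>C\<^esub> \<delta>\<^bsub>C\<^esub> Y \<otimes>\<^bsub>C\<^esub> Idn C (Dual C X)) \<cdot>\<^bsub>C\<^esub> \<delta>\<^bsub>C\<^esub> X \<and>
        \<epsilon>\<^bsub>C\<^esub> (X \<odot>\<^bsub>C\<^esub> Y) =
          \<epsilon>\<^bsub>C\<^esub> Y \<cdot>\<^bsub>C\<^esub> (Idn C (Dual C Y) \<otimes>\<^bsub>C\<^esub> \<epsilon>\<^bsub>C\<^esub> X \<otimes>\<^bsub>C\<^esub> Idn C Y))"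

section \<open>Selective monoidal and rigid categories\<close>

locale selective_monoidal_category =
  monoidal_category C + selective_category C suave congenial
  for C :: "('o, 'm, 'z) mcat_scheme" (structure) and suave congenial +
  assumes TensM_suave: "\<lbrakk>f \<in> suave; g \<in> suave\<rbrakk> \<Longrightarrow> f \<otimes> g \<in> suave"
    and TensM_congenial:
      "\<lbrakk>(f, g) \<in> congenial; (f', g') \<in> congenial\<rbrakk> \<Longrightarrow> (f \<otimes> f', g \<otimes> g') \<in> congenial"

locale highly_selective_monoidal_category =
  selective_monoidal_category C suave congenial +
  highly_selective_category C suave congenial reductions coreductions
  for C :: "('o, 'm, 'z) mcat_scheme" (structure)
    and suave congenial reductions coreductions +
  assumes TensM_reductions:
      "\<lbrakk>f \<in> reductions; g \<in> reductions\<rbrakk> \<Longrightarrow> f \<otimes> g \<in> reductions"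
    and TensM_coreductions:
      "\<lbrakk>f \<in> coreductions; g \<in> coreductions\<rbrakk> \<Longrightarrow> f \<otimes> g \<in> coreductions"

text \<open>The duality functor is contravariant, so it reverses the order in a congenial pair.\<close>

locale selective_rigid_category =
  rigid_category C + selective_monoidal_category C suave congenial
  for C :: "('o, 'm, 'z) rcat_scheme" (structure) and suave congenial +
  assumes Coev_suave: "X \<in> Obj C \<Longrightarrow> \<delta> X \<in> suave"
    and Ev_suave: "X \<in> Obj C \<Longrightarrow> \<epsilon> X \<in> suave"
    and DualM_selective: "(f, g) \<in> congenial \<Longrightarrow> (DualM C g, DualM C f) \<in> congenial"
    and Coev_congenial_right:
      "\<lbrakk>Y \<in> Obj C; Z \<in> Obj C; f \<in> suave; Src C f = Y \<odot> Z\<rbrakk>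
        \<Longrightarrow> (f \<otimes> Idn C (Dual C Z), Idn C Y \<otimes> \<delta> Z) \<in> congenial"
    and Coev_congenial_left:
      "\<lbrakk>Y \<in> Obj C; Z \<in> Obj C; f \<in> suave; Src C f = Y \<odot> Z\<rbrakk>
        \<Longrightarrow> (Idn C (Dual C Y) \<otimes> f, \<delta> (Dual C Y) \<otimes> Idn C Z) \<in> congenial"

locale highly_selective_rigid_category =
  selective_rigid_category C suave congenial +
  highly_selective_monoidal_category C suave congenial reductions coreductions
  for C :: "('o, 'm, 'z) rcat_scheme" (structure)
    and suave congenial reductions coreductions +
  assumes Coev_coreduction: "X \<in> Obj C \<Longrightarrow> \<delta> X \<in> coreductions"
    and Ev_reduction: "X \<in> Obj C \<Longrightarrow> \<epsilon> X \<in> reductions"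
    and DualM_reduction: "f \<in> reductions \<Longrightarrow> DualM C f \<in> coreductions"
    and DualM_coreduction: "f \<in> coreductions \<Longrightarrow> DualM C f \<in> reductions"

section \<open>The Wehrheim--Woodward category\<close>

text \<open>The smallest equivalence relation on \<open>A\<close> relating all pairs of elements of \<open>A\<close> in \<open>r\<close>.\<close>

definition generated_equiv :: "'a set \<Rightarrow> 'a rel \<Rightarrow> 'a rel" where
  "generated_equiv A r = \<Inter>{R. equiv A R \<and> r \<inter> A \<times> A \<subseteq> R}"

definition paths :: "('o, 'm, 'z) cat_scheme \<Rightarrow> 'm set \<Rightarrow> (int \<Rightarrow> 'm) set" where
  "paths C S = {f. (\<forall>i. f i \<in> S) \<and> (\<forall>i. composable C (f i) (f (i + 1))) \<and>
                   finite {i. f i \<notin> Idn C ` Obj C}}"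

definition path_tgt :: "('o, 'm, 'z) cat_scheme \<Rightarrow> (int \<Rightarrow> 'm) \<Rightarrow> 'o" where
  "path_tgt C f = (THE X. X \<in> Obj C \<and> (\<exists>N. \<forall>i\<le>N. f i = Idn C X))"

definition path_src :: "('o, 'm, 'z) cat_scheme \<Rightarrow> (int \<Rightarrow> 'm) \<Rightarrow> 'o" where
  "path_src C f = (THE X. X \<in> Obj C \<and> (\<exists>N. \<forall>i\<ge>N. f i = Idn C X))"

text \<open>
  Insertion shifts the entries from position \<open>k\<close> on to the right. Inserting an identity where
  all entries to the left are identities therefore shifts the whole sequence, so that the
  generated relation does not depend on which side is moved.
\<close>

definition insert_identity ::
    "('o, 'm, 'z) cat_scheme \<Rightarrow> int \<Rightarrow> (int \<Rightarrow> 'm) \<Rightarrow> int \<Rightarrow> 'm" where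
  "insert_identity C k f =
     (\<lambda>i. if i < k then f i else if i = k then Idn C (Tgt C (f k)) else f (i - 1))"

definition path_equiv :: "('o, 'm, 'z) cat_scheme \<Rightarrow> 'm set \<Rightarrow> (int \<Rightarrow> 'm) rel" where
  "path_equiv C S = generated_equiv (paths C S) {(f, insert_identity C k f) | f k. True}"

definition path_class :: "('o, 'm, 'z) cat_scheme \<Rightarrow> 'm set \<Rightarrow> (int \<Rightarrow> 'm) \<Rightarrow> (int \<Rightarrow> 'm) set"
  where "path_class C S f = path_equiv C S `` {f}"

text \<open>
  \<open>concatenate n m f g\<close> consists of the entries of \<open>f\<close> before position \<open>n\<close> followed by those of
  \<open>g\<close> from position \<open>m\<close> on; it is used when all the entries discarded are identities.
\<close>

definition concatenate :: "int \<Rightarrow> int \<Rightarrow> (int \<Rightarrow> 'm) \<Rightarrow> (int \<Rightarrow> 'm) \<Rightarrow> int \<Rightarrow> 'm" where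
  "concatenate n m f g = (\<lambda>i. if i < n then f i else g (i - n + m))"

text \<open>
  Operations on equivalence classes, here and below, are the union of the classes obtained
  from all representatives, which is a single class when the operation is well defined.
  Likewise, the end points are those common to all representatives.
\<close>

definition path_category ::
    "('o, 'm, 'z) cat_scheme \<Rightarrow> 'm set \<Rightarrow> ('o, (int \<Rightarrow> 'm) set) cat" where
  "path_category C S =
     \<lparr>Obj = Obj C,
      Mor = paths C S // path_equiv C S,
      Tgt = (\<lambda>a. the_elem (path_tgt C ` a)),
      Src = (\<lambda>a. the_elem (path_src C ` a)),
      Idn = (\<lambda>X. path_class C S (\<lambda>i. Idn C X)),
      Cmp = (\<lambda>a b. \<Union>{path_class C S (concatenate n m f g) | f g n m.
               f \<in> a \<and> g \<in> b \<and>
               (\<forall>i\<ge>n. f i \<in> Idn C ` Obj C) \<and> (\<forall>i<m. g i \<in> Idn C ` Obj C)})\<rparr>"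

definition quotient_category ::
    "('o, 'm, 'z) cat_scheme \<Rightarrow> 'm rel \<Rightarrow> ('o, 'm set) cat" where
  "quotient_category C R =
     \<lparr>Obj = Obj C,
      Mor = Mor C // R,
      Tgt = (\<lambda>a. the_elem (Tgt C ` a)),
      Src = (\<lambda>a. the_elem (Src C ` a)),
      Idn = (\<lambda>X. R `` {Idn C X}),
      Cmp = (\<lambda>a b. \<Union>{R `` {Cmp C f g} | f g. f \<in> a \<and> g \<in> b})\<rparr>"

text \<open>
  Replacing successive entries forming a congenial pair by their composition, followed
  (first case) or preceded (second case) by an identity.
\<close>

definition contraction ::
    "('o, 'm, 'z) cat_scheme \<Rightarrow> ('m \<times> 'm) set \<Rightarrow> (int \<Rightarrow> 'm) rel" where
  "contraction C K =
     {(f, g). \<exists>k. (f k, f (k + 1)) \<in> K \<and>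
        (g = f(k := f k \<cdot>\<^bsub>C\<^esub> f (k + 1), k + 1 := Idn C (Src C (f (k + 1)))) \<or>
         g = f(k := Idn C (Tgt C (f k)), k + 1 := f k \<cdot>\<^bsub>C\<^esub> f (k + 1)))}"

definition WW_equiv ::
    "('o, 'm, 'z) cat_scheme \<Rightarrow> 'm set \<Rightarrow> ('m \<times> 'm) set \<Rightarrow> (int \<Rightarrow> 'm) set rel" where
  "WW_equiv C S K =
     generated_equiv (Mor (path_category C S))
       {(a, b). \<exists>f\<in>a. \<exists>g\<in>b. (f, g) \<in> contraction C K}"

definition WW ::
    "('o, 'm, 'z) cat_scheme \<Rightarrow> 'm set \<Rightarrow> ('m \<times> 'm) set \<Rightarrow> ('o, (int \<Rightarrow> 'm) set set) cat" where
  "WW C S K = quotient_category (path_category C S) (WW_equiv C S K)"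

definition WW_class ::
    "('o, 'm, 'z) cat_scheme \<Rightarrow> 'm set \<Rightarrow> ('m \<times> 'm) set \<Rightarrow> (int \<Rightarrow> 'm)
      \<Rightarrow> (int \<Rightarrow> 'm) set set" where
  "WW_class C S K f = WW_equiv C S K `` {path_class C S f}"

definition single :: "('o, 'm, 'z) cat_scheme \<Rightarrow> 'm \<Rightarrow> int \<Rightarrow> 'm" where
  "single C f =
     (\<lambda>i. if i < 0 then Idn C (Tgt C f) else if i = 0 then f else Idn C (Src C f))"

definition WW_single ::
    "('o, 'm, 'z) cat_scheme \<Rightarrow> 'm set \<Rightarrow> ('m \<times> 'm) set \<Rightarrow> 'm \<Rightarrow> (int \<Rightarrow> 'm) set set" where
  "WW_single C S K f = WW_class C S K (single C f)"

definition WW_monoidal ::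
    "('o, 'm, 'z) mcat_scheme \<Rightarrow> 'm set \<Rightarrow> ('m \<times> 'm) set
      \<Rightarrow> ('o, (int \<Rightarrow> 'm) set set) mcat" where
  "WW_monoidal C S K =
     cat.extend (WW C S K)
       (mcat.fields
          (TensO C)
          (\<lambda>A B. \<Union>{WW_class C S K (\<lambda>i. f i \<otimes>\<^bsub>C\<^esub> g i) | f g. f \<in> \<Union>A \<and> g \<in> \<Union>B})
          (UnitO C))"

definition WW_rigid ::
    "('o, 'm, 'z) rcat_scheme \<Rightarrow> 'm set \<Rightarrow> ('m \<times> 'm) set
      \<Rightarrow> ('o, (int \<Rightarrow> 'm) set set) rcat" where
  "WW_rigid C S K =
     mcat.extend (WW_monoidal C S K)
       (rcat.fields
          (Dual C)
          (\<lambda>X. WW_single C S K (Coev C X))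
          (\<lambda>X. WW_single C S K (Ev C X)))"

end

theory Submission
  imports Defs
begin

text \<open>
  A morphism of the Wehrheim--Woodward category is a path up to two moves: inserting an identity,
  and merging a congenial pair of neighbours into its composition. The equivalence generated by
  these moves is \<open>path_congruence\<close>; the two-step quotient, first by insertions and then by
  contractions, has the same classes, since a contraction is a merge followed by an insertion
  (\<open>WW_equiv_iff\<close>). The whole structure can therefore be studied on representing paths.
  Concatenation respects the moves because a move happens in a bounded region and the point at which
  the paths are cut can be chosen beyond it (\<open>concatenate_cong\<close>).

  The monoidal product is taken entry by entry, so it seems to depend on the way in which the two
  sequences are aligned. The key point is that it does not: inserting an identity at position \<open>j\<close> of
  one factor only, or at position \<open>j + 1\<close>, gives the products
  \<open>\<dots>, 1 \<otimes> g\<^sub>j, f\<^sub>j \<otimes> g\<^sub>j\<^sub>+\<^sub>1, \<dots>\<close> and \<open>\<dots>, f\<^sub>j \<otimes> g\<^sub>j, 1 \<otimes> g\<^sub>j\<^sub>+\<^sub>1, \<dots>\<close>, and both are merges of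
  \<open>\<dots>, 1 \<otimes> g\<^sub>j, f\<^sub>j \<otimes> 1, 1 \<otimes> g\<^sub>j\<^sub>+\<^sub>1, \<dots>\<close> (\<open>tensor_slide\<close>). Repeating this pushes the inserted identity to
  the right until it lies among the identities at the end of the path, where it has no effect.
  A merge in one factor can then be made harmless by first inserting an identity into the other
  (\<open>tensor_merge_left\<close>), so the product is well defined (\<open>tensor_cong\<close>). Once representatives are
  aligned, the axioms of a monoidal category hold entry by entry.

  For a rigid structure, the pairs occurring in the zigzag identities are congenial, so that these
  identities are inherited (\<open>dual_pair_WW\<close>). Coherence needs more. The dual of \<open>f\<close>, with
  target \<open>X\<close> and source \<open>Y\<close>, is the only morphism \<open>g\<close> of its type with
  \<open>\<epsilon> Y \<cdot> (g \<otimes> 1) = \<epsilon> X \<cdot> (1 \<otimes> f)\<close> (\<open>Ev_DualM\<close>, \<open>DualM_unique\<close>). It follows that duality is a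
  contravariant functor and, in the coherent case, that it takes \<open>f \<otimes> 1\<close> to \<open>1 \<otimes> DualM C f\<close> and the
  unit of \<open>Dual C X\<close> to the counit of \<open>X\<close>. As duality preserves congeniality, the
  axiom on pairs \<open>(f \<otimes> 1, 1 \<otimes> \<delta> Z)\<close> turns into the congeniality of \<open>(\<epsilon> X, 1 \<otimes> f)\<close> for all suave \<open>f\<close>
  with target \<open>X\<close> (\<open>Ev_congenial\<close>). With both facts the composition defining the dual of a suave
  morphism can be contracted, so that the dual of the class of \<open>f\<close> is the class of the dual
  (\<open>DualM_WW_single\<close>). The remaining morphisms are compositions of such classes (\<open>WW_induct\<close>), to which
  the involutivity of duality extends by functoriality.

  Finally, any two composable reductions form a congenial pair, and so do any two composable
  coreductions; hence the product of their classes is the class of their product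
  (\<open>monoidal_subcategory_WW_single\<close>).
\<close>

section \<open>Generated equivalence relations\<close>

lemma equiv_generated_equiv: "equiv A (generated_equiv A r)"
proof -
  have top: "A \<times> A \<in> {R. equiv A R \<and> r \<inter> A \<times> A \<subseteq> R}"
    by (auto simp: equiv_def refl_on_def sym_def trans_def)
  show ?thesis
    unfolding generated_equiv_def
    apply (rule equivI)
    subgoal using top by blast
    subgoal by (auto simp: equiv_def refl_on_def)
    subgoal by (auto simp: equiv_def sym_def)
    subgoal unfolding equiv_def trans_def by blast
    done
qed

lemma generated_equivI: "(x, y) \<in> r \<Longrightarrow> x \<in> A \<Longrightarrow> y \<in> A \<Longrightarrow> (x, y) \<in> generated_equiv A r"
  by (auto simp: generated_equiv_def)

lemma generated_equiv_least:
  "equiv A R \<Longrightarrow> r \<inter> A \<times> A \<subseteq> R \<Longrightarrow> generated_equiv A r \<subseteq> R"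
  by (auto simp: generated_equiv_def)

lemma generated_equiv_invariant:
  assumes "(x, y) \<in> generated_equiv A r"
    and "\<And>x y. (x, y) \<in> r \<Longrightarrow> x \<in> A \<Longrightarrow> y \<in> A \<Longrightarrow> \<phi> x = \<phi> y"
  shows "\<phi> x = \<phi> y"
proof -
  have "generated_equiv A r \<subseteq> {(x, y). x \<in> A \<and> y \<in> A \<and> \<phi> x = \<phi> y}"
    by (rule generated_equiv_least)
      (auto simp: equiv_def refl_on_def sym_def trans_def assms(2))
  then show ?thesis using assms(1) by blast
qed

section \<open>Paths\<close>

definition merge :: "('o, 'm, 'z) cat_scheme \<Rightarrow> int \<Rightarrow> (int \<Rightarrow> 'm) \<Rightarrow> int \<Rightarrow> 'm" where
  "merge C k f =
     (\<lambda>i. if i < k then f i else if i = k then f k \<cdot>\<^bsub>C\<^esub> f (k + 1) else f (i + 1))"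

text \<open>
  Merging shortens the path, where a contraction keeps the length by adding an identity. The set \<open>K\<close>
  is arbitrary, so that the empty set gives the equivalence of paths and the congenial pairs give
  the equivalence defining the Wehrheim--Woodward category.
\<close>

definition path_congruence ::
    "('o, 'm, 'z) cat_scheme \<Rightarrow> 'm set \<Rightarrow> ('m \<times> 'm) set \<Rightarrow> (int \<Rightarrow> 'm) rel" where
  "path_congruence C S K = generated_equiv (paths C S)
     ({(f, insert_identity C k f) | f k. True} \<union>
      {(f, merge C k f) | f k. (f k, f (k + 1)) \<in> K})"

lemma path_equiv_eq: "path_equiv C S = path_congruence C S {}"
  by (simp add: path_equiv_def path_congruence_def)

lemma equiv_path_congruence: "equiv (paths C S) (path_congruence C S K)"
  by (simp add: path_congruence_def equiv_generated_equiv)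

lemma path_congruence_paths:
  "(f, g) \<in> path_congruence C S K \<Longrightarrow> f \<in> paths C S \<and> g \<in> paths C S"
  using equiv_path_congruence[of C S K] by (auto simp: equiv_def)

lemma path_congruence_refl: "f \<in> paths C S \<Longrightarrow> (f, f) \<in> path_congruence C S K"
  using equiv_path_congruence[of C S K] by (auto simp: equiv_def refl_on_def)

lemma path_congruence_sym:
  "(f, g) \<in> path_congruence C S K \<Longrightarrow> (g, f) \<in> path_congruence C S K"
  using equiv_path_congruence[of C S K] by (auto simp: equiv_def sym_def)

lemma path_congruence_trans [trans]:
  "(f, g) \<in> path_congruence C S K \<Longrightarrow> (g, h) \<in> path_congruence C S K
    \<Longrightarrow> (f, h) \<in> path_congruence C S K"
  using equiv_path_congruence[of C S K] by (meson equivE transD)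

text \<open>
  Only these properties of suave morphisms and congenial pairs enter the construction of the
  category. They hold for every selective category and, with the same suave morphisms, when no pair
  is congenial (\<open>suave_paths_empty\<close>); in this way each fact about the congruence also applies to the
  equivalence of paths.
\<close>

locale suave_paths = category C for C :: "('o, 'm, 'z) cat_scheme" (structure) +
  fixes S :: "'m set" and K :: "('m \<times> 'm) set"
  assumes S_Mor: "S \<subseteq> Mor C"
    and Idn_S: "X \<in> Obj C \<Longrightarrow> Idn C X \<in> S"
    and K_S: "(f, g) \<in> K \<Longrightarrow> f \<in> S \<and> g \<in> S \<and> composable C f g \<and> f \<cdot> g \<in> S"
begin

abbreviation "Ids \<equiv> Idn C ` Obj C"
abbreviation "ins \<equiv> insert_identity C"

lemma suave_paths_empty: "suave_paths C S {}"
  by unfold_locales (auto simp: S_Mor Idn_S)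

lemma path_entry:
  assumes "f \<in> paths C S"
  shows "f i \<in> S" "f i \<in> Mor C" "composable C (f i) (f (i + 1))" "Src C (f i) = Tgt C (f (i + 1))"
    "Tgt C (f i) \<in> Obj C" "Src C (f i) \<in> Obj C"
  using assms S_Mor Tgt_closed Src_closed by (auto simp: paths_def composable_def)

text \<open>
  The finiteness condition on a path is used only through bounds on its support.
\<close>

lemma pathI:
  assumes "\<And>i. f i \<in> S" and "\<And>i. Src C (f i) = Tgt C (f (i + 1))"
    and "\<And>i. i < a \<Longrightarrow> f i \<in> Ids" and "\<And>i. i \<ge> b \<Longrightarrow> f i \<in> Ids"
  shows "f \<in> paths C S"
proof -
  have "{i. f i \<notin> Ids} \<subseteq> {a..<b}"
  proof
    fix i assume "i \<in> {i. f i \<notin> Ids}"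
    then show "i \<in> {a..<b}"
      using assms(3)[of i] assms(4)[of i] by (cases "i < a"; cases "i \<ge> b") auto
  qed
  then have "finite {i. f i \<notin> Ids}"
    by (rule finite_subset) simp
  then show ?thesis
    using assms(1,2) S_Mor by (auto simp: paths_def composable_def)
qed

lemma path_bounds:
  assumes "f \<in> paths C S"
  obtains a b where "a \<le> L" "b \<ge> U" "\<And>i. i < a \<Longrightarrow> f i \<in> Ids" "\<And>i. i \<ge> b \<Longrightarrow> f i \<in> Ids"
proof -
  have fin: "finite {i. f i \<notin> Ids}" using assms by (simp add: paths_def)
  define M where "M = insert L (insert U {i. f i \<notin> Ids})"
  have M: "finite M" "L \<in> M" "U \<in> M" "\<And>i. i \<notin> M \<Longrightarrow> f i \<in> Ids"
    using fin by (auto simp: M_def)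
  show thesis
  proof (rule that[of "Min M" "Max M + 1"])
    show "f i \<in> Ids" if "i < Min M" for i using that M by (metis Min_le not_le)
    show "f i \<in> Ids" if "i \<ge> Max M + 1" for i
    proof (rule M(4))
      show "i \<notin> M" using that Max_ge[OF M(1), of i] by linarith
    qed
    show "Min M \<le> L" using M by simp
    show "U \<le> Max M + 1" using M Max_ge[of M U] by linarith
  qed
qed

lemma Ids_eq: "e \<in> Ids \<Longrightarrow> e = Idn C (Tgt C e) \<and> Src C e = Tgt C e"
  by (auto simp: Tgt_Idn Src_Idn)

text \<open>
  An identity has equal source and target, so all the identities to the left of the support of a path
  are the identity of one object, which is then the target. The lemma \<open>right_tail\<close> is the mirror
  image.
\<close>

lemma left_tail:
  assumes f: "f \<in> paths C S" and a: "\<And>i. i < a \<Longrightarrow> f i \<in> Ids"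
  shows "i \<le> a \<Longrightarrow> Tgt C (f i) = path_tgt C f" "i < a \<Longrightarrow> f i = Idn C (path_tgt C f)"
    "path_tgt C f \<in> Obj C"
proof -
  define X where "X = Tgt C (f a)"
  have X: "X \<in> Obj C" using path_entry[OF f] by (simp add: X_def)
  have T: "Tgt C (f i) = X" if "i \<le> a" for i
    using that
  proof (induction i rule: int_le_induct)
    case base then show ?case by (simp add: X_def)
  next
    case (step i)
    then show ?case using Ids_eq[OF a, of "i - 1"] path_entry(4)[OF f, of "i - 1"] by simp
  qed
  have I: "f i = Idn C X" if "i < a" for i using Ids_eq[OF a[OF that]] T that by simp
  have "path_tgt C f = X"
    unfolding path_tgt_def
  proof (rule the_equality)
    show "X \<in> Obj C \<and> (\<exists>N. \<forall>i\<le>N. f i = Idn C X)"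
      using X I by (intro conjI exI[of _ "a - 1"]) auto
    fix Y assume "Y \<in> Obj C \<and> (\<exists>N. \<forall>i\<le>N. f i = Idn C Y)"
    then obtain N where Y: "Y \<in> Obj C" and N: "\<forall>i\<le>N. f i = Idn C Y" by blast
    have "Idn C X = Idn C Y" using N[rule_format, of "min N (a - 1)"] I[of "min N (a - 1)"] by simp
    then show "Y = X" using Tgt_Idn X Y by metis
  qed
  then show "i \<le> a \<Longrightarrow> Tgt C (f i) = path_tgt C f" "i < a \<Longrightarrow> f i = Idn C (path_tgt C f)"
    "path_tgt C f \<in> Obj C"
    using T I X by auto
qed

lemma right_tail:
  assumes f: "f \<in> paths C S" and b: "\<And>i. i \<ge> b \<Longrightarrow> f i \<in> Ids"
  shows "i \<ge> b \<Longrightarrow> Tgt C (f i) = path_src C f" "i \<ge> b \<Longrightarrow> f i = Idn C (path_src C f)"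
    "path_src C f \<in> Obj C"
proof -
  define X where "X = Tgt C (f b)"
  have X: "X \<in> Obj C" using path_entry[OF f] by (simp add: X_def)
  have T: "Tgt C (f i) = X" if "i \<ge> b" for i
    using that
  proof (induction i rule: int_ge_induct)
    case base then show ?case by (simp add: X_def)
  next
    case (step i)
    then show ?case using Ids_eq[OF b, of "i"] path_entry(4)[OF f, of i] by simp
  qed
  have I: "f i = Idn C X" if "i \<ge> b" for i using Ids_eq[OF b[OF that]] T that by simp
  have "path_src C f = X"
    unfolding path_src_def
  proof (rule the_equality)
    show "X \<in> Obj C \<and> (\<exists>N. \<forall>i\<ge>N. f i = Idn C X)"
      using X I by (intro conjI exI[of _ b]) auto
    fix Y assume "Y \<in> Obj C \<and> (\<exists>N. \<forall>i\<ge>N. f i = Idn C Y)"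
    then obtain N where Y: "Y \<in> Obj C" and N: "\<forall>i\<ge>N. f i = Idn C Y" by blast
    have "Idn C X = Idn C Y" using N[rule_format, of "max N b"] I[of "max N b"] by simp
    then show "Y = X" using Tgt_Idn X Y by metis
  qed
  then show "i \<ge> b \<Longrightarrow> Tgt C (f i) = path_src C f" "i \<ge> b \<Longrightarrow> f i = Idn C (path_src C f)"
    "path_src C f \<in> Obj C"
    using T I X by auto
qed

lemma path_ends_Obj: "f \<in> paths C S \<Longrightarrow> path_tgt C f \<in> Obj C \<and> path_src C f \<in> Obj C"
proof -
  assume f: "f \<in> paths C S"
  obtain a b where "a \<le> 0" "b \<ge> 0"
    and ab: "\<And>i. i < a \<Longrightarrow> f i \<in> Ids" "\<And>i. i \<ge> b \<Longrightarrow> f i \<in> Ids"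
    by (rule path_bounds[OF f, of 0 0]) (rule that)
  show ?thesis using left_tail(3)[OF f ab(1)] right_tail(3)[OF f ab(2)] by simp
qed

text \<open>The bounds \<open>L\<close> and \<open>U\<close> serve to place the tails beyond the positions affected by a move.\<close>

lemma path_tails:
  assumes "f \<in> paths C S"
  obtains a b where "a \<le> L" "b \<ge> U"
    "\<And>i. i < a \<Longrightarrow> f i = Idn C (path_tgt C f)" "\<And>i. i \<ge> b \<Longrightarrow> f i = Idn C (path_src C f)"
proof -
  obtain a b where ab: "a \<le> L" "b \<ge> U" "\<And>i. i < a \<Longrightarrow> f i \<in> Ids" "\<And>i. i \<ge> b \<Longrightarrow> f i \<in> Ids"
    by (rule path_bounds[OF assms, of L U]) (rule that)
  show thesis
    using that[OF ab(1,2)] left_tail(2)[OF assms ab(3)] right_tail(2)[OF assms ab(4)] by blast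
qed

lemma path_tgtI:
  assumes "f \<in> paths C S" "X \<in> Obj C" "\<And>i. i < a \<Longrightarrow> f i = Idn C X"
  shows "path_tgt C f = X"
proof -
  have "f i \<in> Ids" if "i < a" for i using assms that by auto
  from left_tail(1)[OF assms(1) this, where i = "a - 1"] show ?thesis
    using assms(3)[of "a - 1"] Tgt_Idn[OF assms(2)] by simp
qed

lemma path_srcI:
  assumes "f \<in> paths C S" "X \<in> Obj C" "\<And>i. i \<ge> b \<Longrightarrow> f i = Idn C X"
  shows "path_src C f = X"
proof -
  have "f i \<in> Ids" if "i \<ge> b" for i using assms that by auto
  from right_tail(1)[OF assms(1) this, where i = b] show ?thesis
    using assms(3)[of b] Tgt_Idn[OF assms(2)] by simp
qed

lemma constant_path: 
  assumes "X \<in> Obj C" 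
  shows "(\<lambda>i. Idn C X) \<in> paths C S" "path_tgt C (\<lambda>i. Idn C X) = X" "path_src C (\<lambda>i. Idn C X) = X"
proof -
  show p: "(\<lambda>i. Idn C X) \<in> paths C S"
    by (rule pathI) (auto simp: assms Idn_S Tgt_Idn Src_Idn)
  show "path_tgt C (\<lambda>i. Idn C X) = X" "path_src C (\<lambda>i. Idn C X) = X"
    using path_tgtI[OF p assms] path_srcI[OF p assms] by auto
qed

lemma ins_path:
  assumes f: "f \<in> paths C S"
  shows "ins k f \<in> paths C S" "path_tgt C (ins k f) = path_tgt C f"
    "path_src C (ins k f) = path_src C f"
proof -
  obtain a b where ab: "a \<le> k" "b \<ge> k + 1"
    "\<And>i. i < a \<Longrightarrow> f i = Idn C (path_tgt C f)" "\<And>i. i \<ge> b \<Longrightarrow> f i = Idn C (path_src C f)"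
    by (rule path_tails[OF f, of k "k + 1"]) (rule that)
  have ends: "\<And>i. i < a \<Longrightarrow> ins k f i = Idn C (path_tgt C f)"
    "\<And>i. i \<ge> b + 1 \<Longrightarrow> ins k f i = Idn C (path_src C f)"
    using ab by (auto simp: insert_identity_def)
  note O = path_ends_Obj[OF f]
  show p: "ins k f \<in> paths C S"
  proof (rule pathI)
    show "ins k f i \<in> S" for i
      using path_entry[OF f] by (auto simp: insert_identity_def Idn_S)
    show "Src C (ins k f i) = Tgt C (ins k f (i + 1))" for i
      using path_entry(4)[OF f, of i] path_entry(4)[OF f, of "i - 1"] path_entry(5)[OF f]
      by (auto simp: insert_identity_def Tgt_Idn Src_Idn)
    show "ins k f i \<in> Ids" if "i < a" for i using ends that O by auto
    show "ins k f i \<in> Ids" if "i \<ge> b + 1" for i using ends that O by auto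
  qed
  show "path_tgt C (ins k f) = path_tgt C f" "path_src C (ins k f) = path_src C f"
    using path_tgtI[OF p _ ends(1)] path_srcI[OF p _ ends(2)] O by auto
qed

lemma merge_path:
  assumes f: "f \<in> paths C S" and K: "f k \<cdot> f (k + 1) \<in> S"
  shows "merge C k f \<in> paths C S" "path_tgt C (merge C k f) = path_tgt C f"
    "path_src C (merge C k f) = path_src C f"
proof -
  obtain a b where ab: "a \<le> k" "b \<ge> k + 2"
    "\<And>i. i < a \<Longrightarrow> f i = Idn C (path_tgt C f)" "\<And>i. i \<ge> b \<Longrightarrow> f i = Idn C (path_src C f)"
    by (rule path_tails[OF f, of k "k + 2"]) (rule that)
  have ends: "\<And>i. i < a \<Longrightarrow> merge C k f i = Idn C (path_tgt C f)"
    "\<And>i. i \<ge> b \<Longrightarrow> merge C k f i = Idn C (path_src C f)"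
    using ab by (auto simp: merge_def)
  note O = path_ends_Obj[OF f]
  show p: "merge C k f \<in> paths C S"
  proof (rule pathI)
    show "merge C k f i \<in> S" for i
      using path_entry[OF f] K by (auto simp: merge_def)
    show "Src C (merge C k f i) = Tgt C (merge C k f (i + 1))" for i
      using path_entry(4)[OF f, of i] path_entry(4)[OF f, of "i + 1"]
        Src_Cmp[OF path_entry(3)[OF f, of k]] Tgt_Cmp[OF path_entry(3)[OF f, of k]]
      by (auto simp: merge_def)
    show "merge C k f i \<in> Ids" if "i < a" for i using ends that O by auto
    show "merge C k f i \<in> Ids" if "i \<ge> b" for i using ends that O by auto
  qed
  show "path_tgt C (merge C k f) = path_tgt C f" "path_src C (merge C k f) = path_src C f"
    using path_tgtI[OF p _ ends(1)] path_srcI[OF p _ ends(2)] O by auto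
qed

abbreviation "R \<equiv> path_congruence C S K"

lemma ins_R: "f \<in> paths C S \<Longrightarrow> (f, ins k f) \<in> R"
  unfolding path_congruence_def by (rule generated_equivI) (auto simp: ins_path)

lemma merge_R: "f \<in> paths C S \<Longrightarrow> (f k, f (k + 1)) \<in> K \<Longrightarrow> (f, merge C k f) \<in> R"
  unfolding path_congruence_def by (rule generated_equivI) (auto simp: merge_path K_S)

lemma R_invariant [consumes 1, case_names ins merge]:
  assumes "(f, g) \<in> R"
    and "\<And>f k. f \<in> paths C S \<Longrightarrow> \<phi> (ins k f) = \<phi> f"
    and "\<And>f k. f \<in> paths C S \<Longrightarrow> (f k, f (k + 1)) \<in> K \<Longrightarrow> \<phi> (merge C k f) = \<phi> f"
  shows "\<phi> f = \<phi> g"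
  using assms(1) unfolding path_congruence_def
  by (rule generated_equiv_invariant) (auto simp: assms(2,3))

lemma R_ends: "(f, g) \<in> R \<Longrightarrow> path_tgt C f = path_tgt C g \<and> path_src C f = path_src C g"
  using R_invariant[of f g "\<lambda>f. (path_tgt C f, path_src C f)"]
  by (auto simp: ins_path merge_path K_S)

lemma R_class_eq: "f \<in> paths C S \<Longrightarrow> g \<in> paths C S \<Longrightarrow> R `` {f} = R `` {g} \<longleftrightarrow> (f, g) \<in> R"
  using eq_equiv_class_iff[OF equiv_path_congruence] .

section \<open>Concatenation\<close>

text \<open>
  The condition for \<open>concatenate n m f g\<close> to represent the composition of \<open>f\<close> and \<open>g\<close>.
\<close>

definition joinable :: "int \<Rightarrow> int \<Rightarrow> (int \<Rightarrow> 'm) \<Rightarrow> (int \<Rightarrow> 'm) \<Rightarrow> bool" where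
  "joinable n m f g \<longleftrightarrow> f \<in> paths C S \<and> g \<in> paths C S \<and> path_src C f = path_tgt C g \<and>
     (\<forall>i\<ge>n. f i \<in> Ids) \<and> (\<forall>i<m. g i \<in> Ids)"

lemma joinable_tails:
  assumes "joinable n m f g"
  shows "i \<ge> n \<Longrightarrow> f i = Idn C (path_src C f)" "i < m \<Longrightarrow> g i = Idn C (path_src C f)"
    "i \<ge> n \<Longrightarrow> Tgt C (f i) = path_src C f" "i \<le> m \<Longrightarrow> Tgt C (g i) = path_src C f"
proof -
  have f: "f \<in> paths C S" "\<And>i. i \<ge> n \<Longrightarrow> f i \<in> Ids"
    and g: "g \<in> paths C S" "\<And>i. i < m \<Longrightarrow> g i \<in> Ids" and e: "path_src C f = path_tgt C g"
    using assms by (auto simp only: joinable_def)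
  show "f i = Idn C (path_src C f)" if "i \<ge> n" using right_tail(2)[OF f that] .
  show "g i = Idn C (path_src C f)" if "i < m" using left_tail(2)[OF g that] e by simp
  show "Tgt C (f i) = path_src C f" if "i \<ge> n" using right_tail(1)[OF f that] .
  show "Tgt C (g i) = path_src C f" if "i \<le> m" using left_tail(1)[OF g that] e by simp
qed

lemma joinable_exists:
  assumes "f \<in> paths C S" "g \<in> paths C S" "path_src C f = path_tgt C g"
  obtains n m where "n \<ge> U" "m \<le> L" "joinable n m f g"
proof -
  obtain n where "n \<ge> U" "\<And>i. i \<ge> n \<Longrightarrow> f i \<in> Ids" using path_bounds[OF assms(1)] by metis
  moreover obtain m where "m \<le> L" "\<And>i. i < m \<Longrightarrow> g i \<in> Ids" using path_bounds[OF assms(2)] by metis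
  ultimately show thesis using that assms by (auto simp: joinable_def)
qed

lemma concatenate_path:
  assumes j: "joinable n m f g"
  shows "concatenate n m f g \<in> paths C S" "path_tgt C (concatenate n m f g) = path_tgt C f"
    "path_src C (concatenate n m f g) = path_src C g"
proof -
  have f: "f \<in> paths C S" and g: "g \<in> paths C S" using j by (auto simp: joinable_def)
  obtain a where a: "a \<le> n" "\<And>i. i < a \<Longrightarrow> f i = Idn C (path_tgt C f)"
    using path_tails[OF f] by metis
  obtain b where b: "b \<ge> m" "\<And>i. i \<ge> b \<Longrightarrow> g i = Idn C (path_src C g)"
    using path_tails[OF g] by metis
  have ends: "\<And>i. i < a \<Longrightarrow> concatenate n m f g i = Idn C (path_tgt C f)"
    "\<And>i. i \<ge> b + n - m \<Longrightarrow> concatenate n m f g i = Idn C (path_src C g)"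
    using a b by (auto simp: concatenate_def)
  note O = path_ends_Obj[OF f] path_ends_Obj[OF g]
  show p: "concatenate n m f g \<in> paths C S"
  proof (rule pathI)
    show "concatenate n m f g i \<in> S" for i
      using path_entry[OF f] path_entry[OF g] by (auto simp: concatenate_def)
    have "Src C (f i) = Tgt C (g m)" if "i + 1 = n" for i
      using path_entry(4)[OF f, of i] that joinable_tails(3,4)[OF j] by simp
    then show "Src C (concatenate n m f g i) = Tgt C (concatenate n m f g (i + 1))" for i
      using path_entry(4)[OF f, of i] path_entry(4)[OF g, of "i - n + m"]
      by (cases "i + 1 = n") (auto simp: concatenate_def algebra_simps)
    show "concatenate n m f g i \<in> Ids" if "i < a" for i using ends that O by auto
    show "concatenate n m f g i \<in> Ids" if "i \<ge> b + n - m" for i using ends that O by auto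
  qed
  show "path_tgt C (concatenate n m f g) = path_tgt C f"
    "path_src C (concatenate n m f g) = path_src C g"
    using path_tgtI[OF p _ ends(1)] path_srcI[OF p _ ends(2)] O by auto
qed

text \<open>
  Cutting the first path one step later, or the second one step earlier, inserts an identity at the
  junction.
\<close>

lemma concatenate_later:
  assumes j: "joinable n m f g"
  shows "(concatenate n m f g, concatenate (n + int k) (m - int l) f g) \<in> R"
proof -
  have j': "joinable (n + int k) (m - int l) f g" for k l using j by (auto simp: joinable_def)
  have 1: "concatenate (n + 1) m f g = ins n (concatenate n m f g)"
    if j: "joinable n m f g" for n m
    using joinable_tails[OF j]
    by (auto simp: fun_eq_iff concatenate_def insert_identity_def algebra_simps)
  have 2: "concatenate n (m - 1) f g = ins n (concatenate n m f g)"
    if j: "joinable n m f g" for n m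
    using joinable_tails[OF j]
    by (auto simp: fun_eq_iff concatenate_def insert_identity_def algebra_simps)
  have A: "(concatenate n m f g, concatenate (n + int k) m f g) \<in> R" for k
  proof (induction k)
    case 0
    then show ?case using path_congruence_refl concatenate_path(1)[OF j] by simp
  next
    case (Suc k)
    have jk: "joinable (n + int k) m f g" using j'[of k 0] by simp
    show ?case
      using path_congruence_trans[OF Suc ins_R[OF concatenate_path(1)[OF jk]]] 1[OF jk]
      by (metis add.assoc add.commute of_nat_Suc)
  qed
  show ?thesis
  proof (induction l)
    case 0
    then show ?case using A by simp
  next
    case (Suc l)
    show ?case
      using path_congruence_trans[OF Suc ins_R[OF concatenate_path(1)[OF j'[of k l]]]] 2[OF j'[of k l]]
      by (metis add.commute diff_diff_eq of_nat_Suc)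
  qed
qed

lemma concatenate_independent:
  assumes "joinable n m f g" and "joinable n' m' f g"
  shows "(concatenate n m f g, concatenate n' m' f g) \<in> R"
proof -
  define N M where "N = max n n'" and "M = min m m'"
  have "(concatenate n m f g, concatenate N M f g) \<in> R"
    using concatenate_later[OF assms(1), of "nat (N - n)" "nat (m - M)"] by (simp add: N_def M_def)
  moreover have "(concatenate n' m' f g, concatenate N M f g) \<in> R"
    using concatenate_later[OF assms(2), of "nat (N - n')" "nat (m' - M)"] by (simp add: N_def M_def)
  ultimately show ?thesis by (metis path_congruence_sym path_congruence_trans)
qed

text \<open>
  The union over all cutting points avoids a choice, and it is empty if the paths are not composable,
  so that invariance under the moves can be stated without a side condition.
\<close>

definition join_class :: "(int \<Rightarrow> 'm) \<Rightarrow> (int \<Rightarrow> 'm) \<Rightarrow> (int \<Rightarrow> 'm) set" where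
  "join_class f g = \<Union>{R `` {concatenate n m f g} | n m. joinable n m f g}"

lemma join_class_eq:
  assumes "joinable n m f g" shows "join_class f g = R `` {concatenate n m f g}"
proof -
  have "R `` {concatenate n' m' f g} = R `` {concatenate n m f g}" if "joinable n' m' f g" for n' m'
    using R_class_eq[THEN iffD2, OF concatenate_path(1)[OF that] concatenate_path(1)[OF assms]
        concatenate_independent[OF that assms]] .
  then show ?thesis using assms unfolding join_class_def by blast
qed

lemma join_class_ends: "path_src C f \<noteq> path_tgt C g \<Longrightarrow> join_class f g = {}"
  by (simp add: join_class_def joinable_def)

text \<open>
  The cutting point is chosen to the right of the move, which then also takes place in the
  concatenation. For a move in the second path, a cutting point to its left serves the same purpose.
\<close>

lemma join_class_step_left:
  assumes f: "f \<in> paths C S" and g: "g \<in> paths C S"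
  shows "join_class (ins k f) g = join_class f g"
    and "(f k, f (k + 1)) \<in> K \<Longrightarrow> join_class (merge C k f) g = join_class f g"
proof -
  show "join_class (ins k f) g = join_class f g"
  proof (cases "path_src C f = path_tgt C g")
    case True
    obtain n m where nm: "n \<ge> k + 3" "joinable n m f g"
      using joinable_exists[OF f g True] by metis
    have j: "joinable (n + 1) m (ins k f) g"
      using nm ins_path[OF f] by (auto simp: joinable_def insert_identity_def)
    have "concatenate (n + 1) m (ins k f) g = ins k (concatenate n m f g)"
      using nm by (auto simp: fun_eq_iff concatenate_def insert_identity_def algebra_simps)
    then show ?thesis
      using join_class_eq[OF j] join_class_eq[OF nm(2)] ins_R R_class_eq ins_path
        concatenate_path(1)[OF nm(2)] by metis
  qed (simp add: join_class_ends ins_path[OF f])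
  assume K: "(f k, f (k + 1)) \<in> K"
  then have S: "f k \<cdot> f (k + 1) \<in> S" by (simp add: K_S)
  show "join_class (merge C k f) g = join_class f g"
  proof (cases "path_src C f = path_tgt C g")
    case True
    obtain n m where nm: "n \<ge> k + 3" "joinable n m f g"
      using joinable_exists[OF f g True] by metis
    have j: "joinable (n - 1) m (merge C k f) g"
      using nm merge_path[OF f S] by (auto simp: joinable_def merge_def)
    have "concatenate (n - 1) m (merge C k f) g = merge C k (concatenate n m f g)"
      using nm by (auto simp: fun_eq_iff concatenate_def merge_def algebra_simps)
    moreover have "(concatenate n m f g, merge C k (concatenate n m f g)) \<in> R"
      using merge_R[OF concatenate_path(1)[OF nm(2)], of k] K nm(1) by (simp add: concatenate_def)
    ultimately show ?thesis
      using join_class_eq[OF j] join_class_eq[OF nm(2)] R_class_eq path_congruence_paths by metis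
  qed (simp add: join_class_ends merge_path[OF f S])
qed

lemma join_class_step_right:
  assumes f: "f \<in> paths C S" and g: "g \<in> paths C S"
  shows "join_class f (ins k g) = join_class f g"
    and "(g k, g (k + 1)) \<in> K \<Longrightarrow> join_class f (merge C k g) = join_class f g"
proof -
  show "join_class f (ins k g) = join_class f g"
  proof (cases "path_src C f = path_tgt C g")
    case True
    obtain n m where nm: "m \<le> k - 1" "joinable n m f g"
      using joinable_exists[OF f g True] by metis
    have j: "joinable n m f (ins k g)"
      using nm ins_path[OF g] by (auto simp: joinable_def insert_identity_def)
    have "concatenate n m f (ins k g) = ins (k - m + n) (concatenate n m f g)"
      using nm by (auto simp: fun_eq_iff concatenate_def insert_identity_def algebra_simps)
    then show ?thesis
      using join_class_eq[OF j] join_class_eq[OF nm(2)] ins_R R_class_eq ins_path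
        concatenate_path(1)[OF nm(2)] by metis
  qed (simp add: join_class_ends ins_path[OF g])
  assume K: "(g k, g (k + 1)) \<in> K"
  then have S: "g k \<cdot> g (k + 1) \<in> S" by (simp add: K_S)
  show "join_class f (merge C k g) = join_class f g"
  proof (cases "path_src C f = path_tgt C g")
    case True
    obtain n m where nm: "m \<le> k - 1" "joinable n m f g"
      using joinable_exists[OF f g True] by metis
    have j: "joinable n m f (merge C k g)"
      using nm merge_path[OF g S] by (auto simp: joinable_def merge_def)
    have "concatenate n m f (merge C k g) = merge C (k - m + n) (concatenate n m f g)"
      using nm by (auto simp: fun_eq_iff concatenate_def merge_def algebra_simps)
    moreover have "(concatenate n m f g, merge C (k - m + n) (concatenate n m f g)) \<in> R"
      using merge_R[OF concatenate_path(1)[OF nm(2)], of "k - m + n"] K nm(1)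
      by (simp add: concatenate_def algebra_simps)
    ultimately show ?thesis
      using join_class_eq[OF j] join_class_eq[OF nm(2)] R_class_eq path_congruence_paths by metis
  qed (simp add: join_class_ends merge_path[OF g S])
qed

lemma join_class_cong:
  assumes f: "(f, f') \<in> R" and g: "(g, g') \<in> R"
  shows "join_class f g = join_class f' g'"
proof -
  have "join_class f g = join_class f' g"
    using f by (rule R_invariant) (use g path_congruence_paths join_class_step_left in blast)+
  also have "\<dots> = join_class f' g'"
    using g by (rule R_invariant) (use f path_congruence_paths join_class_step_right in blast)+
  finally show ?thesis .
qed

lemma concatenate_cong:
  assumes "joinable n m f g" "joinable n' m' f' g'" "(f, f') \<in> R" "(g, g') \<in> R"
  shows "(concatenate n m f g, concatenate n' m' f' g') \<in> R"
  using join_class_cong[OF assms(3,4)] join_class_eq[OF assms(1)] join_class_eq[OF assms(2)]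
    R_class_eq concatenate_path(1)[OF assms(1)] concatenate_path(1)[OF assms(2)] by simp

end

section \<open>The Wehrheim--Woodward category\<close>

context suave_paths
begin

abbreviation "W \<equiv> WW C S K"
abbreviation "ww \<equiv> WW_class C S K"
abbreviation "R0 \<equiv> path_congruence C S {}"

lemma R0_subset_R: "R0 \<subseteq> R"
proof -
  have "{(f, ins k f) |f k. True} \<inter> paths C S \<times> paths C S \<subseteq> R"
    using ins_R by auto
  then show ?thesis
    unfolding path_congruence_def[of C S "{}"]
    by (intro generated_equiv_least equiv_path_congruence) simp
qed

lemma path_class_eq: "path_class C S f = R0 `` {f}"
  by (simp add: path_class_def path_equiv_eq)

lemma Mor_path_category: "Mor (path_category C S) = path_class C S ` paths C S"
  by (auto simp: path_category_def quotient_def path_class_def)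

lemma path_class_eq_iff:
  "f \<in> paths C S \<Longrightarrow> g \<in> paths C S \<Longrightarrow> path_class C S f = path_class C S g \<longleftrightarrow> (f, g) \<in> R0"
  unfolding path_class_eq using eq_equiv_class_iff[OF equiv_path_congruence] .

lemma path_class_self: "f \<in> paths C S \<Longrightarrow> f \<in> path_class C S f"
  unfolding path_class_eq using path_congruence_refl by blast

text \<open>
  The two forms of a contraction differ from a merge by the insertion of an identity after or before
  the composition. Up to equivalence of paths they thus agree with the merge, and with each other.
\<close>

lemma contraction_merge:
  assumes f: "f \<in> paths C S" and fg: "(f, g) \<in> contraction C K"
  obtains k where "(f k, f (k + 1)) \<in> K" "(merge C k f, g) \<in> R0"
proof -
  interpret free: suave_paths C S "{}" by (rule suave_paths_empty)
  obtain k where K: "(f k, f (k + 1)) \<in> K"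
    and "g = f(k := f k \<cdot> f (k + 1), k + 1 := Idn C (Src C (f (k + 1)))) \<or>
         g = f(k := Idn C (Tgt C (f k)), k + 1 := f k \<cdot> f (k + 1))"
    using fg by (auto simp: contraction_def)
  moreover have "f(k := f k \<cdot> f (k + 1), k + 1 := Idn C (Src C (f (k + 1)))) = ins (k + 1) (merge C k f)"
    using path_entry(4)[OF f, of "k + 1"] by (auto simp: fun_eq_iff insert_identity_def merge_def)
  moreover have "f(k := Idn C (Tgt C (f k)), k + 1 := f k \<cdot> f (k + 1)) = ins k (merge C k f)"
    using Tgt_Cmp[OF path_entry(3)[OF f, of k]]
    by (auto simp: fun_eq_iff insert_identity_def merge_def)
  moreover have "merge C k f \<in> paths C S" using merge_path f K K_S by blast
  ultimately show thesis using that free.ins_R by metis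
qed

lemma merge_contraction:
  assumes f: "f \<in> paths C S" and K: "(f k, f (k + 1)) \<in> K"
  shows "(f, ins (k + 1) (merge C k f)) \<in> contraction C K"
proof -
  have "f(k := f k \<cdot> f (k + 1), k + 1 := Idn C (Src C (f (k + 1)))) = ins (k + 1) (merge C k f)"
    using path_entry(4)[OF f, of "k + 1"] by (auto simp: fun_eq_iff insert_identity_def merge_def)
  then show ?thesis using K by (auto simp: contraction_def)
qed

text \<open>
  Forming the quotient by insertions first and by contractions afterwards amounts to forming it by
  both at once. In one direction, pulling the equivalence on classes back to paths gives an
  equivalence relation with both moves; in the other, the saturation \<open>\<phi>\<close> of a class is unchanged by
  contractions.
\<close>

lemma WW_equiv_iff:
  assumes f: "f \<in> paths C S" and g: "g \<in> paths C S"
  shows "(path_class C S f, path_class C S g) \<in> WW_equiv C S K \<longleftrightarrow> (f, g) \<in> R"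
proof
  interpret free: suave_paths C S "{}" by (rule suave_paths_empty)
  let ?Q = "{(f, g). f \<in> paths C S \<and> g \<in> paths C S \<and>
      (path_class C S f, path_class C S g) \<in> WW_equiv C S K}"
  have E: "equiv (path_class C S ` paths C S) (WW_equiv C S K)"
    unfolding WW_equiv_def Mor_path_category by (rule equiv_generated_equiv)
  have Q: "equiv (paths C S) ?Q"
  proof (rule equivI)
    show "refl_on (paths C S) ?Q" using E by (auto simp: equiv_def refl_on_def)
    show "sym ?Q" using E by (auto simp: equiv_def sym_def)
    show "trans ?Q" using E unfolding equiv_def trans_def by blast
  qed auto
  have I: "(f, ins k f) \<in> ?Q" if "f \<in> paths C S" for f k
  proof -
    have "path_class C S f = path_class C S (ins k f)"
      using path_class_eq_iff[OF that ins_path(1)[OF that]] free.ins_R[OF that] by simp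
    then show ?thesis using that ins_path(1)[OF that] E by (auto simp: equiv_def refl_on_def)
  qed
  have M: "(f, merge C k f) \<in> ?Q" if f: "f \<in> paths C S" and K: "(f k, f (k + 1)) \<in> K" for f k
  proof -
    let ?m = "merge C k f"
    have m: "?m \<in> paths C S" using merge_path f K K_S by blast
    note m' = ins_path(1)[OF m, of "k + 1"]
    have "(path_class C S f, path_class C S (ins (k + 1) ?m)) \<in> WW_equiv C S K"
      unfolding WW_equiv_def Mor_path_category
      by (rule generated_equivI)
        (use merge_contraction[OF f K] path_class_self f m' in auto)
    then have "(f, ins (k + 1) ?m) \<in> ?Q" using f m' by blast
    moreover have "(ins (k + 1) ?m, ?m) \<in> ?Q"
      using Q by (rule equivE) (erule symD, rule I[OF m])
    ultimately show ?thesis using Q by (elim equivE) (erule transD)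
  qed
  have "R \<subseteq> ?Q"
    unfolding path_congruence_def
  proof (rule generated_equiv_least[OF Q], rule subsetI)
    fix p
    assume "p \<in> ({(f, ins k f) |f k. True} \<union> {(f, merge C k f) |f k. (f k, f (k + 1)) \<in> K}) \<inter>
        paths C S \<times> paths C S"
    then show "p \<in> ?Q"
      by (elim IntE UnE CollectE exE conjE SigmaE) (simp_all only: prod.inject I M)
  qed
  then show "(f, g) \<in> R \<Longrightarrow> (path_class C S f, path_class C S g) \<in> WW_equiv C S K" by blast
next
  assume "(path_class C S f, path_class C S g) \<in> WW_equiv C S K"
  define \<phi> where "\<phi> a = \<Union>((\<lambda>f. R `` {f}) ` a)" for a
  have \<phi>: "\<phi> (path_class C S h) = R `` {h}" if "h \<in> paths C S" for h
  proof -
    have "R `` {h'} = R `` {h}" if "h' \<in> path_class C S h" for h'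
      using that R0_subset_R equiv_class_eq[OF equiv_path_congruence] unfolding path_class_eq
      by blast
    then show ?thesis using path_class_self[OF that] unfolding \<phi>_def by blast
  qed
  have "\<phi> (path_class C S f) = \<phi> (path_class C S g)"
    using \<open>(path_class C S f, path_class C S g) \<in> WW_equiv C S K\<close> unfolding WW_equiv_def
  proof (rule generated_equiv_invariant)
    fix a b
    assume "(a, b) \<in> {(a, b). \<exists>f\<in>a. \<exists>g\<in>b. (f, g) \<in> contraction C K}"
      and ab: "a \<in> Mor (path_category C S)" "b \<in> Mor (path_category C S)"
    then obtain f g where fg: "f \<in> a" "g \<in> b" "(f, g) \<in> contraction C K" by blast
    have cls: "h \<in> paths C S \<and> path_class C S h = a" if "h \<in> a" "a \<in> Mor (path_category C S)" for h a
    proof -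
      from that(2) obtain h0 where h0: "h0 \<in> paths C S" "a = path_class C S h0"
        by (auto simp: Mor_path_category)
      have "(h0, h) \<in> R0" using that(1) h0 by (simp add: path_class_eq)
      then show ?thesis using path_class_eq_iff[OF h0(1), of h] h0 path_congruence_paths by blast
    qed
    have f: "f \<in> paths C S" "path_class C S f = a" using cls fg(1) ab(1) by auto
    have g: "g \<in> paths C S" "path_class C S g = b" using cls fg(2) ab(2) by auto
    obtain k where "(f k, f (k + 1)) \<in> K" "(merge C k f, g) \<in> R0"
      using contraction_merge[OF f(1) fg(3)] .
    then have "(f, g) \<in> R" using merge_R[OF f(1)] R0_subset_R path_congruence_trans by blast
    then show "\<phi> a = \<phi> b" using \<phi> f g R_class_eq by metis
  qed
  then show "(f, g) \<in> R" using \<phi> f g R_class_eq by metis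
qed

lemma Obj_WW: "Obj W = Obj C"
  by (simp add: WW_def quotient_category_def path_category_def)

lemma Mor_WW: "Mor W = ww ` paths C S"
  by (auto simp: WW_def quotient_category_def Mor_path_category quotient_def WW_class_def)

lemma equiv_WW_equiv: "equiv (path_class C S ` paths C S) (WW_equiv C S K)"
  unfolding WW_equiv_def Mor_path_category by (rule equiv_generated_equiv)

lemma WW_class_eq_iff:
  assumes "f \<in> paths C S" "g \<in> paths C S"
  shows "ww f = ww g \<longleftrightarrow> (f, g) \<in> R"
  unfolding WW_class_def
  by (subst eq_equiv_class_iff[OF equiv_WW_equiv]) (auto simp: WW_equiv_iff assms)

lemma WW_class_cong: "(f, g) \<in> R \<Longrightarrow> ww f = ww g"
  using WW_class_eq_iff path_congruence_paths by blast

lemma WW_class_members: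
  assumes "f \<in> paths C S" 
  shows "ww f = path_class C S ` (R `` {f})"
proof
  show "ww f \<subseteq> path_class C S ` (R `` {f})"
  proof
    fix b assume b: "b \<in> ww f"
    then have "b \<in> path_class C S ` paths C S"
      using equiv_WW_equiv unfolding WW_class_def equiv_def by blast
    then show "b \<in> path_class C S ` (R `` {f})"
      using b WW_equiv_iff[OF assms] unfolding WW_class_def by blast
  qed
  show "path_class C S ` (R `` {f}) \<subseteq> ww f"
    using WW_equiv_iff[OF assms] path_congruence_paths unfolding WW_class_def by blast
qed

lemma Union_WW_class:
  assumes "f \<in> paths C S" 
  shows "\<Union>(ww f) = R `` {f}"
proof -
  have "g \<in> R `` {f}" if "(f, h) \<in> R" "(h, g) \<in> R0" for g h
    using that R0_subset_R path_congruence_trans by blast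
  moreover have "g \<in> path_class C S g" if "(f, g) \<in> R" for g
    using that path_class_self path_congruence_paths by blast
  ultimately show ?thesis
    unfolding WW_class_members[OF assms] path_class_eq by blast
qed

lemma path_category_ends:
  assumes "f \<in> paths C S"
  shows "Tgt (path_category C S) (path_class C S f) = path_tgt C f"
    "Src (path_category C S) (path_class C S f) = path_src C f"
proof -
  have "path_tgt C ` path_class C S f = {path_tgt C f} \<and> path_src C ` path_class C S f = {path_src C f}"
  proof -
    have "path_tgt C g = path_tgt C f \<and> path_src C g = path_src C f" if "g \<in> path_class C S f" for g
      using that R0_subset_R R_ends unfolding path_class_eq by (metis Image_singleton_iff subsetD)
    then show ?thesis using path_class_self[OF assms] by blast
  qed
  then show "Tgt (path_category C S) (path_class C S f) = path_tgt C f"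
    "Src (path_category C S) (path_class C S f) = path_src C f"
    by (simp_all add: path_category_def)
qed

lemma WW_ends:
  assumes f: "f \<in> paths C S"
  shows "Tgt W (ww f) = path_tgt C f" "Src W (ww f) = path_src C f"
proof -
  have *: "Tgt (path_category C S) (path_class C S g) = path_tgt C f \<and>
      Src (path_category C S) (path_class C S g) = path_src C f" if "(f, g) \<in> R" for g
    using that path_category_ends R_ends path_congruence_paths by metis
  have "R `` {f} \<noteq> {}" using path_congruence_refl[OF f] by blast
  then have "Tgt (path_category C S) ` ww f = {path_tgt C f}"
    "Src (path_category C S) ` ww f = {path_src C f}"
    unfolding WW_class_members[OF f] image_image using * by (simp_all add: image_constant_conv cong: image_cong_simp)
  then show "Tgt W (ww f) = path_tgt C f" "Src W (ww f) = path_src C f"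
    by (simp_all add: WW_def quotient_category_def)
qed

lemma Idn_WW: "Idn W X = ww (\<lambda>i. Idn C X)"
  by (simp add: WW_def quotient_category_def path_category_def WW_class_def)

lemma Cmp_path_category:
  assumes j: "joinable n m f g"
  shows "Cmp (path_category C S) (path_class C S f) (path_class C S g) =
    path_class C S (concatenate n m f g)"
proof -
  interpret free: suave_paths C S "{}" by (rule suave_paths_empty)
  have f: "f \<in> paths C S" and g: "g \<in> paths C S" using j by (auto simp: joinable_def)
  have "path_class C S (concatenate n' m' f' g') = path_class C S (concatenate n m f g)"
    if "f' \<in> path_class C S f" "g' \<in> path_class C S g"
      "\<forall>i\<ge>n'. f' i \<in> Ids" "\<forall>i<m'. g' i \<in> Ids" for f' g' n' m'
  proof -
    have R0: "(f, f') \<in> R0" "(g, g') \<in> R0" using that by (auto simp: path_class_eq)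
    then have j': "joinable n' m' f' g'"
      using j that(3,4) free.R_ends path_congruence_paths unfolding joinable_def by metis
    show ?thesis
      using path_class_eq_iff[THEN iffD2, OF _ _ free.concatenate_cong[OF j j' R0]]
        concatenate_path(1)[OF j] concatenate_path(1)[OF j'] by simp
  qed
  moreover have "f \<in> path_class C S f" "g \<in> path_class C S g" "\<forall>i\<ge>n. f i \<in> Ids" "\<forall>i<m. g i \<in> Ids"
    using f g j path_class_self by (auto simp only: joinable_def)
  ultimately show ?thesis
    unfolding path_category_def cat.simps by blast
qed

lemma Cmp_WW:
  assumes j: "joinable n m f g"
  shows "Cmp W (ww f) (ww g) = ww (concatenate n m f g)"
proof -
  have f: "f \<in> paths C S" and g: "g \<in> paths C S" using j by (auto simp: joinable_def)
  have *: "WW_equiv C S K `` {Cmp (path_category C S) a b} = ww (concatenate n m f g)"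
    if ab: "a \<in> ww f" "b \<in> ww g" for a b
  proof -
    obtain f' g' where f': "(f, f') \<in> R" "a = path_class C S f'"
      and g': "(g, g') \<in> R" "b = path_class C S g'"
      using ab WW_class_members f g by auto
    have "f' \<in> paths C S" "g' \<in> paths C S" "path_src C f' = path_tgt C g'"
      using f'(1) g'(1) path_congruence_paths R_ends j unfolding joinable_def by metis+
    then obtain n' m' where j': "joinable n' m' f' g'" using joinable_exists by metis
    show ?thesis
      unfolding f'(2) g'(2) Cmp_path_category[OF j'] WW_class_def[symmetric]
      using WW_class_cong[OF concatenate_cong[OF j j' f'(1) g'(1)]] by simp
  qed
  have "path_class C S f \<in> ww f" "path_class C S g \<in> ww g"
    unfolding WW_class_members[OF f] WW_class_members[OF g]
    using path_congruence_refl[OF f] path_congruence_refl[OF g] by blast+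
  then show ?thesis
    unfolding WW_def quotient_category_def cat.simps using * by blast
qed

lemma composable_WW:
  assumes f: "f \<in> paths C S" and g: "g \<in> paths C S"
  shows "composable W (ww f) (ww g) \<longleftrightarrow> path_src C f = path_tgt C g"
  using assms by (auto simp: composable_def Mor_WW WW_ends)

lemma WW_MorE:
  assumes "A \<in> Mor W" 
  obtains f where "f \<in> paths C S" "A = ww f"
  using assms by (auto simp: Mor_WW)

lemma WW_composableE:
  assumes "composable W A B"
  obtains f g n m where "joinable n m f g" "A = ww f" "B = ww g" "n \<ge> U" "m \<le> L"
proof -
  obtain f g where fg: "f \<in> paths C S" "g \<in> paths C S" "A = ww f" "B = ww g"
    using assms WW_MorE unfolding composable_def by metis
  then have "path_src C f = path_tgt C g" using assms composable_WW by blast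
  then show thesis using joinable_exists[OF fg(1,2)] that fg by metis
qed

text \<open>
  The condition \<open>m \<le> n'\<close> says that the two cuts of \<open>g\<close> do not overlap; only then do both bracketings
  discard the same entries.
\<close>

lemma concatenate_assoc:
  assumes nm: "joinable n m f g" and n'm': "joinable n' m' g h" and "m \<le> n'"
  shows "joinable (n' - m + n) m' (concatenate n m f g) h"
    "joinable n m f (concatenate n' m' g h)"
    "concatenate (n' - m + n) m' (concatenate n m f g) h =
      concatenate n m f (concatenate n' m' g h)"
proof -
  show "joinable (n' - m + n) m' (concatenate n m f g) h"
    using assms concatenate_path[OF nm]
    by (auto simp: joinable_def) (auto simp: concatenate_def)
  show "joinable n m f (concatenate n' m' g h)"
    using assms concatenate_path[OF n'm']
    by (auto simp: joinable_def) (auto simp: concatenate_def)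
  show "concatenate (n' - m + n) m' (concatenate n m f g) h =
      concatenate n m f (concatenate n' m' g h)"
    using assms(3) by (auto simp: concatenate_def fun_eq_iff algebra_simps)
qed

theorem category_WW: "category W"
proof
  fix A assume "A \<in> Mor W"
  then obtain f where f: "f \<in> paths C S" "A = ww f" by (rule WW_MorE)
  show "Tgt W A \<in> Obj W" "Src W A \<in> Obj W"
    using f path_ends_Obj by (simp_all add: WW_ends Obj_WW)
  obtain a b where "a \<le> 0" "b \<ge> 0" and ab: "\<And>i. i < a \<Longrightarrow> f i = Idn C (path_tgt C f)"
    "\<And>i. i \<ge> b \<Longrightarrow> f i = Idn C (path_src C f)"
    by (rule path_tails[OF f(1), of 0 0]) (rule that)
  note O = path_ends_Obj[OF f(1)]
  let ?t = "\<lambda>i :: int. Idn C (path_tgt C f)" and ?s = "\<lambda>i :: int. Idn C (path_src C f)"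
  have "joinable a a ?t f" "concatenate a a ?t f = f"
    using f O ab constant_path[of "path_tgt C f"] by (auto simp: joinable_def concatenate_def fun_eq_iff)
  then show "Cmp W (Idn W (Tgt W A)) A = A"
    using Cmp_WW[of a a ?t f] by (simp add: f(2) WW_ends[OF f(1)] Idn_WW)
  have "joinable b b f ?s" "concatenate b b f ?s = f"
    using f O ab constant_path[of "path_src C f"] by (auto simp: joinable_def concatenate_def fun_eq_iff)
  then show "Cmp W A (Idn W (Src W A)) = A"
    using Cmp_WW[of b b f ?s] by (simp add: f(2) WW_ends[OF f(1)] Idn_WW)
next
  fix X assume "X \<in> Obj W"
  then have X: "X \<in> Obj C" by (simp add: Obj_WW)
  show "Idn W X \<in> Mor W" using constant_path[OF X] by (auto simp: Idn_WW Mor_WW)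
  show "Tgt W (Idn W X) = X" "Src W (Idn W X) = X"
    using constant_path[OF X] by (simp_all add: Idn_WW WW_ends)
next
  fix A B assume AB: "composable W A B"
  obtain f g n m where *: "joinable n m f g" "A = ww f" "B = ww g"
    by (rule WW_composableE[OF AB])
  note c = concatenate_path[OF *(1)]
  show "Cmp W A B \<in> Mor W"
    using c(1) by (simp add: *(2,3) Cmp_WW[OF *(1)] Mor_WW)
  show "Tgt W (Cmp W A B) = Tgt W A" "Src W (Cmp W A B) = Src W B"
    using c *(1) by (auto simp: * Cmp_WW[OF *(1)] WW_ends joinable_def)
next
  fix A B D assume AB: "composable W A B" and BD: "composable W B D"
  obtain f g h where fgh: "f \<in> paths C S" "g \<in> paths C S" "h \<in> paths C S"
    "A = ww f" "B = ww g" "D = ww h"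
    using AB BD WW_MorE unfolding composable_def by metis
  have e: "path_src C f = path_tgt C g" "path_src C g = path_tgt C h"
    using AB BD fgh composable_WW by blast+
  obtain n m where nm: "joinable n m f g" using joinable_exists[OF fgh(1,2) e(1)] by metis
  obtain n' m' where n'm': "n' \<ge> m" "joinable n' m' g h"
    using joinable_exists[OF fgh(2,3) e(2)] by metis
  show "Cmp W (Cmp W A B) D = Cmp W A (Cmp W B D)"
    using concatenate_assoc[OF nm n'm'(2,1)]
    by (simp add: fgh(4-6) Cmp_WW[OF nm] Cmp_WW[OF n'm'(2)] Cmp_WW)
qed

text \<open>
  To the left of its support a path consists of identities, and inserting one more of them moves the
  whole path.
\<close>

lemma shift_nat_R: "f \<in> paths C S \<Longrightarrow> (f, \<lambda>i. f (i - int d)) \<in> R"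
proof (induction d)
  case 0
  then show ?case using path_congruence_refl by simp
next
  case (Suc d)
  let ?g = "\<lambda>i. f (i - int d)"
  have g: "?g \<in> paths C S" using Suc path_congruence_paths by blast
  obtain a b where "a \<le> 0" "b \<ge> 0" and ab: "\<And>i. i < a \<Longrightarrow> ?g i = Idn C (path_tgt C ?g)"
    "\<And>i. i \<ge> b \<Longrightarrow> ?g i = Idn C (path_src C ?g)"
    by (rule path_tails[OF g, of 0 0]) (rule that)
  have "path_tgt C ?g \<in> Obj C" using path_ends_Obj[OF g] by simp
  have "ins (a - 1) ?g = (\<lambda>i. ?g (i - 1))"
  proof
    fix i
    consider "i < a - 1" | "i = a - 1" | "i > a - 1" by linarith
    then show "ins (a - 1) ?g i = ?g (i - 1)"
    proof cases
      case 1 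
      then show ?thesis using ab(1)[of i] ab(1)[of "i - 1"] by (simp add: insert_identity_def)
    next
      case 2
      then show ?thesis 
        using ab(1)[of "a - 1"] ab(1)[of "a - 2"] Tgt_Idn[OF \<open>path_tgt C ?g \<in> Obj C\<close>]
        by (simp add: insert_identity_def)
    qed (simp add: insert_identity_def)
  qed
  also have "\<dots> = (\<lambda>i. f (i - int (Suc d)))" by (simp add: algebra_simps)
  finally show ?case using path_congruence_trans[OF Suc.IH[OF Suc.prems] ins_R[OF g, of "a - 1"]] by simp
qed

lemma shift_R: 
  assumes "f \<in> paths C S" 
  shows "(f, \<lambda>i. f (i + d)) \<in> R"
proof (cases "d \<le> 0")
  case True
  then show ?thesis using shift_nat_R[OF assms, of "nat (- d)"] by simp
next
  case False
  let ?g = "\<lambda>i. f (i + d)"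
  have g: "?g \<in> paths C S"
  proof -
    obtain a b where "a \<le> 0" "b \<ge> 0" and ab: "\<And>i. i < a \<Longrightarrow> f i \<in> Ids" "\<And>i. i \<ge> b \<Longrightarrow> f i \<in> Ids"
      by (rule path_bounds[OF assms, of 0 0]) (rule that)
    show ?thesis
      by (rule pathI[of _ "a - d" "b - d"])
        (use path_entry[OF assms] ab in \<open>auto simp: algebra_simps\<close>)
  qed
  show ?thesis using shift_nat_R[OF g, of "nat d"] False path_congruence_sym by simp
qed

lemma single_path:
  assumes "f \<in> S"
  shows "single C f \<in> paths C S" "path_tgt C (single C f) = Tgt C f"
    "path_src C (single C f) = Src C f"
proof -
  have f: "f \<in> Mor C" using assms S_Mor by blast
  note O = Tgt_closed[OF f] Src_closed[OF f]
  show p: "single C f \<in> paths C S"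
    by (rule pathI[of _ 0 1]) (auto simp: single_def assms O Idn_S Tgt_Idn Src_Idn)
  show "path_tgt C (single C f) = Tgt C f"
    by (rule path_tgtI[OF p, of _ 0]) (auto simp: single_def O)
  show "path_src C (single C f) = Src C f"
    by (rule path_srcI[OF p, of _ 1]) (auto simp: single_def O)
qed

abbreviation "ws \<equiv> WW_single C S K"

lemma WW_single:
  assumes "f \<in> S"
  shows "ws f \<in> Mor W" "Tgt W (ws f) = Tgt C f" "Src W (ws f) = Src C f"
  using single_path[OF assms] by (auto simp: WW_single_def Mor_WW WW_ends)

lemma WW_single_Idn: "X \<in> Obj C \<Longrightarrow> ws (Idn C X) = Idn W X"
  by (simp add: WW_single_def Idn_WW single_def Tgt_Idn Src_Idn if_distrib cong: if_cong)

text \<open>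
  The sequence of \<open>f\<close> and \<open>g\<close> represents the composition of their classes, and it can be merged.
\<close>

lemma WW_single_Cmp:
  assumes K: "(f, g) \<in> K"
  shows "Cmp W (ws f) (ws g) = ws (f \<cdot> g)"
proof -
  have f: "f \<in> S" and g: "g \<in> S" and fg: "composable C f g" "f \<cdot> g \<in> S" using K_S[OF K] by auto
  have M: "f \<in> Mor C" "g \<in> Mor C" using f g S_Mor by auto
  have j: "joinable 1 0 (single C f) (single C g)"
    using single_path[OF f] single_path[OF g] fg Tgt_closed Src_closed M
    by (auto simp: joinable_def composable_def) (auto simp: single_def)
  let ?h = "concatenate 1 0 (single C f) (single C g)"
  have "merge C 0 ?h = single C (f \<cdot> g)"
    by (auto simp: fun_eq_iff merge_def concatenate_def single_def Tgt_Cmp[OF fg(1)] Src_Cmp[OF fg(1)])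
  moreover have "(?h, merge C 0 ?h) \<in> R"
    by (rule merge_R[OF concatenate_path(1)[OF j]]) (simp add: concatenate_def single_def K)
  ultimately show ?thesis
    using Cmp_WW[OF j] WW_class_cong by (simp add: WW_single_def)
qed

text \<open>
  Splitting off the first entry of a path shows that every morphism of the Wehrheim--Woodward
  category is a finite composition of classes of suave morphisms.
\<close>

lemma WW_induct [consumes 1, case_names Idn Cmp]:
  assumes "A \<in> Mor W"
    and Idn: "\<And>X. X \<in> Obj C \<Longrightarrow> P (Idn W X)"
    and Cmp: "\<And>f B. f \<in> S \<Longrightarrow> composable W (ws f) B \<Longrightarrow> P B \<Longrightarrow> P (Cmp W (ws f) B)"
  shows "P A"
proof -
  have main: "P (ww f)"
    if "f \<in> paths C S" "\<And>i. i < a \<Longrightarrow> f i \<in> Ids" "\<And>i. i \<ge> a + int k \<Longrightarrow> f i \<in> Ids" for f a k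
    using that
  proof (induction k arbitrary: f a)
    case 0
    have "f i = Idn C (path_tgt C f)" for i
    proof (cases "i < a")
      case True
      then show ?thesis using left_tail(2)[OF 0(1,2)] by blast
    next
      case False
      have "path_src C f = path_tgt C f"
        using left_tail(1)[OF 0(1,2), of a] right_tail(1)[OF 0(1), of a a] 0(3) by simp
      then show ?thesis using right_tail(2)[OF 0(1), of a i] 0(3) False by simp
    qed
    then have "f = (\<lambda>i. Idn C (path_tgt C f))" by blast
    then have "ww f = Idn W (path_tgt C f)" using Idn_WW by metis
    then show ?case using Idn path_ends_Obj 0(1) by simp
  next
    case (Suc k)
    note f = path_entry[OF Suc.prems(1)]
    \<comment> \<open>The path \<open>v\<close> is \<open>f\<close> without its first entry; joined to that entry it gives a shift of \<open>f\<close>.\<close>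
    define v where "v i = (if i \<le> a then Idn C (Src C (f a)) else f i)" for i
    have v: "v \<in> paths C S"
    proof (rule pathI)
      show "v i \<in> S" for i using f by (auto simp: v_def Idn_S)
      show "Src C (v i) = Tgt C (v (i + 1))" for i
        using f(4)[of i] f(4)[of a] f(6)[of a] by (cases "i = a") (auto simp: v_def Tgt_Idn Src_Idn)
      show "v i \<in> Ids" if "i < a + 1" for i using that f(6) by (auto simp: v_def)
      show "v i \<in> Ids" if "i \<ge> a + 1 + int k" for i using that f(6) Suc.prems(3) by (auto simp: v_def)
    qed
    have vt: "path_tgt C v = Src C (f a)"
      by (rule path_tgtI[OF v, of _ a]) (auto simp: v_def f)
    have j: "joinable 1 (a + 1) (single C (f a)) v"
      using v vt single_path[OF f(1)] f(6) by (auto simp: joinable_def) (auto simp: single_def v_def)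
    have "concatenate 1 (a + 1) (single C (f a)) v i = f (i + a)" for i
    proof -
      have "Tgt C (f a) = path_tgt C f" "i < 0 \<Longrightarrow> f (i + a) = Idn C (path_tgt C f)"
        using left_tail(1)[OF Suc.prems(1,2), of a a] left_tail(2)[OF Suc.prems(1,2), of a "i + a"]
        by simp_all
      then show ?thesis by (cases "i = 0") (auto simp: concatenate_def single_def v_def)
    qed
    then have "concatenate 1 (a + 1) (single C (f a)) v = (\<lambda>i. f (i + a))" by blast
    then have e: "ww f = Cmp W (ws (f a)) (ww v)"
      using Cmp_WW[OF j] WW_class_cong[OF shift_R[OF Suc.prems(1), of a]]
      by (simp add: WW_single_def)
    have "composable W (ws (f a)) (ww v)"
      unfolding WW_single_def using composable_WW single_path[OF f(1)] v vt by simp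
    moreover have "P (ww v)"
      by (rule Suc.IH[OF v, of "a + 1"]) (use f(6) Suc.prems(3) in \<open>auto simp: v_def\<close>)
    ultimately show ?case unfolding e using Cmp f(1) by blast
  qed
  obtain f where f: "f \<in> paths C S" "A = ww f" using assms(1) by (rule WW_MorE)
  obtain a b where ab: "a \<le> 0" "b \<ge> 0" "\<And>i. i < a \<Longrightarrow> f i \<in> Ids" "\<And>i. i \<ge> b \<Longrightarrow> f i \<in> Ids"
    by (rule path_bounds[OF f(1), of 0 0]) (rule that)
  show ?thesis unfolding f(2) by (rule main[OF f(1) ab(3), of a "nat (b - a)"]) (use ab in auto)
qed

end

section \<open>The monoidal structure\<close>

sublocale selective_category \<subseteq> suave_paths C suave congenial
  by unfold_locales (auto dest: congenialD Cmp_suave simp: suave_Mor Idn_suave)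

text \<open>
  The axioms concern only the fields of the smaller record, so they can be checked after
  forgetting the additional ones.
\<close>

lemma category_truncate: "category (cat.truncate E) \<Longrightarrow> category E"
  unfolding category_def composable_def cat.truncate_def by simp

lemma monoidal_category_truncate: "monoidal_category (mcat.truncate E) \<Longrightarrow> monoidal_category E"
  unfolding monoidal_category_def monoidal_category_axioms_def category_def composable_def
    mcat.truncate_def by simp

context selective_monoidal_category
begin

abbreviation tensor :: "(int \<Rightarrow> 'm) \<Rightarrow> (int \<Rightarrow> 'm) \<Rightarrow> int \<Rightarrow> 'm" where
  "tensor f g \<equiv> \<lambda>i. f i \<otimes> g i"

lemma tensor_path:
  assumes f: "f \<in> paths C suave" and g: "g \<in> paths C suave"
  shows "tensor f g \<in> paths C suave"
    "path_tgt C (tensor f g) = path_tgt C f \<odot> path_tgt C g"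
    "path_src C (tensor f g) = path_src C f \<odot> path_src C g"
proof -
  obtain a b where ab: "a \<le> 0" "b \<ge> 0"
    "\<And>i. i < a \<Longrightarrow> f i = Idn C (path_tgt C f)" "\<And>i. i \<ge> b \<Longrightarrow> f i = Idn C (path_src C f)"
    by (rule path_tails[OF f, of 0 0]) (rule that)
  obtain a' b' where ab': "a' \<le> a" "b' \<ge> b"
    "\<And>i. i < a' \<Longrightarrow> g i = Idn C (path_tgt C g)" "\<And>i. i \<ge> b' \<Longrightarrow> g i = Idn C (path_src C g)"
    by (rule path_tails[OF g, of a b]) (rule that)
  note O = path_ends_Obj[OF f] path_ends_Obj[OF g]
  have ends: "\<And>i. i < a' \<Longrightarrow> f i \<otimes> g i = Idn C (path_tgt C f \<odot> path_tgt C g)"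
    "\<And>i. i \<ge> b' \<Longrightarrow> f i \<otimes> g i = Idn C (path_src C f \<odot> path_src C g)"
    using ab ab' O by (simp_all add: TensM_Idn)
  have O': "path_tgt C f \<odot> path_tgt C g \<in> Obj C" "path_src C f \<odot> path_src C g \<in> Obj C"
    using O TensO_closed by auto
  show p: "tensor f g \<in> paths C suave"
  proof (rule pathI[of _ a' b'])
    show "f i \<otimes> g i \<in> suave" for i using path_entry(1) f g TensM_suave by blast
    show "Src C (f i \<otimes> g i) = Tgt C (f (i + 1) \<otimes> g (i + 1))" for i
      using path_entry(2,4)[OF f] path_entry(2,4)[OF g] by (simp add: Src_TensM Tgt_TensM)
  qed (use ends O' in auto)
  show "path_tgt C (tensor f g) = path_tgt C f \<odot> path_tgt C g"
    "path_src C (tensor f g) = path_src C f \<odot> path_src C g"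
    using path_tgtI[OF p O'(1) ends(1)] path_srcI[OF p O'(2) ends(2)] by auto
qed

lemma tensor_ins:
  assumes f: "f \<in> paths C suave" and g: "g \<in> paths C suave"
  shows "tensor (ins k f) (ins k g) = ins k (tensor f g)"
  using path_entry(2,5)[OF f] path_entry(2,5)[OF g]
  by (auto simp: fun_eq_iff insert_identity_def TensM_Idn Tgt_TensM)

lemma Idn_entry_congenial:
  assumes f: "f \<in> paths C suave"
  shows "(Idn C (Tgt C (f k)), f k) \<in> congenial" "(f k, Idn C (Tgt C (f (k + 1)))) \<in> congenial"
  using path_entry[OF f, of k] path_entry[OF f, of "k + 1"]
  by (auto intro!: Idn_congenial Idn_suave simp: composable_def Idn_closed Src_Idn Tgt_Idn)

lemma entry_Idn:
  assumes f: "f \<in> paths C suave"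
  shows "Idn C (Tgt C (f k)) \<cdot> f k = f k" "f k \<cdot> Idn C (Tgt C (f (k + 1))) = f k"
  using path_entry[OF f, of k] by (auto simp: Idn_left Idn_right simp flip: path_entry(4)[OF f])

text \<open>
  The two products are \<open>\<dots>, 1 \<otimes> g\<^sub>j, f\<^sub>j \<otimes> g\<^sub>j\<^sub>+\<^sub>1, \<dots>\<close> and \<open>\<dots>, f\<^sub>j \<otimes> g\<^sub>j, 1 \<otimes> g\<^sub>j\<^sub>+\<^sub>1, \<dots>\<close>. The path \<open>?r\<close>
  below is \<open>\<dots>, 1 \<otimes> g\<^sub>j, f\<^sub>j \<otimes> 1, 1 \<otimes> g\<^sub>j\<^sub>+\<^sub>1, \<dots>\<close>, and merging the first or the second two of these three
  entries gives one or the other. The pairs are congenial as products of congenial pairs with an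
  identity in each.
\<close>

lemma tensor_slide:
  assumes f: "f \<in> paths C suave" and g: "g \<in> paths C suave"
  shows "(tensor (ins j f) g, tensor (ins (j + 1) f) g) \<in> R"
proof -
  let ?r = "tensor (ins j (ins (j + 1) f)) (ins (j + 1) g)"
  have r: "?r \<in> paths C suave" using tensor_path(1) ins_path(1) f g by blast
  have r_at: "?r j = Idn C (Tgt C (f j)) \<otimes> g j" "?r (j + 1) = f j \<otimes> Idn C (Tgt C (g (j + 1)))"
    "?r (j + 2) = Idn C (Tgt C (f (j + 1))) \<otimes> g (j + 1)"
    by (auto simp: insert_identity_def add.commute)
  have c: "(?r j, ?r (j + 1)) \<in> congenial" "(?r (j + 1), ?r (j + 1 + 1)) \<in> congenial"
    using TensM_congenial[OF Idn_entry_congenial(1)[OF f] Idn_entry_congenial(2)[OF g]]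
      TensM_congenial[OF Idn_entry_congenial(2)[OF f] Idn_entry_congenial(1)[OF g]]
      r_at by (simp_all add: add.assoc)
  have "?r j \<cdot> ?r (j + 1) = f j \<otimes> g j" "?r (j + 1) \<cdot> ?r (j + 2) = f j \<otimes> g (j + 1)"
    unfolding r_at
    using TensM_Cmp congenialD[OF Idn_entry_congenial(1)[OF f]] congenialD[OF Idn_entry_congenial(2)[OF f]]
      congenialD[OF Idn_entry_congenial(1)[OF g]] congenialD[OF Idn_entry_congenial(2)[OF g]]
      entry_Idn[OF f] entry_Idn[OF g] by metis+
  then have "merge C j ?r = tensor (ins (j + 1) f) g" "merge C (j + 1) ?r = tensor (ins j f) g"
    by (auto simp: fun_eq_iff merge_def add.assoc) (auto simp: insert_identity_def)
  then have "(?r, tensor (ins (j + 1) f) g) \<in> R" "(?r, tensor (ins j f) g) \<in> R"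
    using merge_R[OF r c(1)] merge_R[OF r c(2)] by (simp_all only:)
  then show ?thesis using path_congruence_sym path_congruence_trans by blast
qed

lemma ins_right_tail:
  assumes f: "f \<in> paths C suave" and b: "\<And>i. i \<ge> b \<Longrightarrow> f i \<in> Ids"
  shows "ins b f = f"
proof
  fix i
  have "i > b \<Longrightarrow> f (i - 1) = f i" "Idn C (Tgt C (f b)) = f b"
    using right_tail(1,2)[OF f, of b] b by (metis order.refl zle_diff1_eq less_imp_le)+
  then show "ins b f i = f i" by (auto simp: insert_identity_def)
qed

text \<open>
  By sliding, the position of the identity inserted into the first factor is irrelevant, and to the
  right of the support of \<open>f\<close> the insertion leaves \<open>f\<close> unchanged.
\<close>

lemma tensor_ins_left:
  assumes f: "f \<in> paths C suave" and g: "g \<in> paths C suave"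
  shows "(tensor f g, tensor (ins j f) g) \<in> R"
proof -
  have *: "(tensor (ins j f) g, tensor (ins (j + int n) f) g) \<in> R" for n
  proof (induction n)
    case 0
    then show ?case using path_congruence_refl[OF tensor_path(1)[OF ins_path(1)[OF f] g]] by simp
  next
    case (Suc n)
    then show ?case
      using path_congruence_trans[OF Suc tensor_slide[OF f g]] by (simp add: algebra_simps)
  qed
  obtain a b where ab: "a \<le> 0" "b \<ge> j" "\<And>i. i < a \<Longrightarrow> f i \<in> Ids" "\<And>i. i \<ge> b \<Longrightarrow> f i \<in> Ids"
    by (rule path_bounds[OF f, of 0 j]) (rule that)
  have "ins b f = f" using ins_right_tail[OF f ab(4)] .
  then show ?thesis using *[of "nat (b - j)"] ab(2) path_congruence_sym by simp
qed

text \<open>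
  Inserting identities into both factors at the same position is an insertion into the product. The
  insertion into the first factor can then be undone by \<open>tensor_ins_left\<close>.
\<close>

lemma tensor_ins_right:
  assumes f: "f \<in> paths C suave" and g: "g \<in> paths C suave"
  shows "(tensor f g, tensor f (ins j g)) \<in> R"
proof -
  have "(tensor f g, tensor (ins j f) (ins j g)) \<in> R"
    unfolding tensor_ins[OF f g] by (rule ins_R[OF tensor_path(1)[OF f g]])
  moreover have "(tensor f (ins j g), tensor (ins j f) (ins j g)) \<in> R"
    by (rule tensor_ins_left[OF f ins_path(1)[OF g]])
  ultimately show ?thesis using path_congruence_sym path_congruence_trans by blast
qed

text \<open>
  If a congenial pair of \<open>f\<close> stands opposite two arbitrary entries of \<open>g\<close>, its product with them
  need not be congenial. After spreading out the paths, it stands opposite \<open>g k\<close> and an identity,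
  which form a congenial pair.
\<close>

lemma tensor_merge_left:
  assumes f: "f \<in> paths C suave" and g: "g \<in> paths C suave" and c: "(f k, f (k + 1)) \<in> congenial"
  shows "(tensor f g, tensor (merge C k f) g) \<in> R"
proof -
  let ?p = "tensor (ins (k + 2) f) (ins (k + 1) g)"
  have m: "merge C k f \<in> paths C suave" using merge_path f c K_S by blast
  have p: "?p \<in> paths C suave" using tensor_path(1) ins_path(1) f g by blast
  have p_at: "?p k = f k \<otimes> g k" "?p (k + 1) = f (k + 1) \<otimes> Idn C (Tgt C (g (k + 1)))"
    by (auto simp: insert_identity_def)
  have "?p k \<cdot> ?p (k + 1) = (f k \<cdot> f (k + 1)) \<otimes> g k"
    unfolding p_at
    using TensM_Cmp congenialD[OF c] congenialD[OF Idn_entry_congenial(2)[OF g]] entry_Idn[OF g] by metis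
  then have mp: "merge C k ?p = tensor (ins (k + 1) (merge C k f)) g"
    by (auto simp: fun_eq_iff merge_def) (auto simp: insert_identity_def algebra_simps)
  have "(tensor f g, ?p) \<in> R"
    using path_congruence_trans[OF tensor_ins_left[OF f g] tensor_ins_right[OF ins_path(1)[OF f] g]] .
  also have "(?p, tensor (ins (k + 1) (merge C k f)) g) \<in> R"
    unfolding mp[symmetric]
    by (rule merge_R[OF p]) (use TensM_congenial[OF c Idn_entry_congenial(2)[OF g]] p_at in simp)
  also have "(tensor (ins (k + 1) (merge C k f)) g, tensor (merge C k f) g) \<in> R"
    by (rule path_congruence_sym[OF tensor_ins_left[OF m g]])
  finally show ?thesis .
qed

lemma tensor_merge_right:
  assumes f: "f \<in> paths C suave" and g: "g \<in> paths C suave" and c: "(g k, g (k + 1)) \<in> congenial"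
  shows "(tensor f g, tensor f (merge C k g)) \<in> R"
proof -
  let ?p = "tensor (ins (k + 1) f) (ins (k + 2) g)"
  have m: "merge C k g \<in> paths C suave" using merge_path g c K_S by blast
  have p: "?p \<in> paths C suave" using tensor_path(1) ins_path(1) f g by blast
  have p_at: "?p k = f k \<otimes> g k" "?p (k + 1) = Idn C (Tgt C (f (k + 1))) \<otimes> g (k + 1)"
    by (auto simp: insert_identity_def)
  have "?p k \<cdot> ?p (k + 1) = f k \<otimes> (g k \<cdot> g (k + 1))"
    unfolding p_at
    using TensM_Cmp congenialD[OF c] congenialD[OF Idn_entry_congenial(2)[OF f]] entry_Idn[OF f] by metis
  then have mp: "merge C k ?p = tensor f (ins (k + 1) (merge C k g))"
    by (auto simp: fun_eq_iff merge_def) (auto simp: insert_identity_def algebra_simps)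
  have "(tensor f g, ?p) \<in> R"
    using path_congruence_trans[OF tensor_ins_left[OF f g] tensor_ins_right[OF ins_path(1)[OF f] g]] .
  also have "(?p, tensor f (ins (k + 1) (merge C k g))) \<in> R"
    unfolding mp[symmetric]
    by (rule merge_R[OF p]) (use TensM_congenial[OF Idn_entry_congenial(2)[OF f] c] p_at in simp)
  also have "(tensor f (ins (k + 1) (merge C k g)), tensor f (merge C k g)) \<in> R"
    by (rule path_congruence_sym[OF tensor_ins_right[OF f m]])
  finally show ?thesis .
qed

lemma tensor_cong:
  assumes f: "(f, f') \<in> R" and g: "(g, g') \<in> R"
  shows "ww (tensor f g) = ww (tensor f' g')"
proof -
  have p: "f' \<in> paths C suave" "g \<in> paths C suave" using f g path_congruence_paths by blast+
  have "ww (tensor f g) = ww (tensor f' g)"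
    using f
    by (rule R_invariant[where \<phi> = "\<lambda>f. ww (tensor f g)"])
      (simp_all add: WW_class_cong[OF tensor_ins_left, symmetric]
        WW_class_cong[OF tensor_merge_left, symmetric] p)
  also have "\<dots> = ww (tensor f' g')"
    using g
    by (rule R_invariant[where \<phi> = "\<lambda>g. ww (tensor f' g)"])
      (simp_all add: WW_class_cong[OF tensor_ins_right, symmetric]
        WW_class_cong[OF tensor_merge_right, symmetric] p)
  finally show ?thesis .
qed

abbreviation "WM \<equiv> WW_monoidal C suave congenial"

lemma WW_monoidal_fields:
  "Obj WM = Obj C" "Mor WM = Mor W" "Tgt WM = Tgt W" "Src WM = Src W" "Idn WM = Idn W"
  "Cmp WM = Cmp W" "TensO WM = TensO C" "UnitO WM = UnitO C"
  by (simp_all add: WW_monoidal_def cat.defs mcat.defs Obj_WW)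

lemma TensM_WW:
  assumes f: "f \<in> paths C suave" and g: "g \<in> paths C suave"
  shows "TensM WM (ww f) (ww g) = ww (tensor f g)"
proof -
  have "TensM WM (ww f) (ww g) = \<Union>{ww (tensor f' g') | f' g'. (f, f') \<in> R \<and> (g, g') \<in> R}"
    by (simp add: WW_monoidal_def cat.defs mcat.defs Union_WW_class f g del: Union_iff)
  moreover have "{ww (tensor f' g') | f' g'. (f, f') \<in> R \<and> (g, g') \<in> R} = {ww (tensor f g)}"
    using tensor_cong[symmetric] path_congruence_refl[OF f] path_congruence_refl[OF g] by blast
  ultimately show ?thesis by simp
qed

lemma composable_WM: "composable WM = composable W"
  by (simp add: composable_def WW_monoidal_fields fun_eq_iff)

lemma joinable_common:
  assumes "joinable n m f g" "joinable n' m' f' g'"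
  shows "joinable (max n n') (min m m') f g" "joinable (max n n') (min m m') f' g'"
  using assms by (auto simp: joinable_def)

lemma joinable_tensor:
  assumes "joinable n m f g" "joinable n m f' g'"
  shows "joinable n m (tensor f f') (tensor g g')"
proof -
  have p: "f \<in> paths C suave" "g \<in> paths C suave" "f' \<in> paths C suave" "g' \<in> paths C suave"
    using assms by (auto simp only: joinable_def)
  have "X \<otimes> Y \<in> Ids" if "X \<in> Ids" "Y \<in> Ids" for X Y
    using that TensO_closed TensM_Idn by auto
  then show ?thesis
    using assms tensor_path[OF p(1,3)] tensor_path[OF p(2,4)] unfolding joinable_def by simp
qed

text \<open>
  For the interchange law, both compositions are formed with the same cutting points, so that the
  product of the concatenations is the concatenation of the products.
\<close>

theorem monoidal_category_WW: "monoidal_category WM"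
proof (rule monoidal_category.intro)
  have "cat.truncate WM = W"
    by (simp add: WW_monoidal_def cat.defs mcat.defs)
  then show "category WM" using category_WW category_truncate by metis
  show "monoidal_category_axioms WM"
  proof
    show "UnitO WM \<in> Obj WM" by (simp add: WW_monoidal_fields UnitO_closed)
  next
    fix X Y assume "X \<in> Obj WM" "Y \<in> Obj WM"
    then have XY: "X \<in> Obj C" "Y \<in> Obj C" by (simp_all add: WW_monoidal_fields)
    show "TensO WM X Y \<in> Obj WM" using XY by (simp add: WW_monoidal_fields TensO_closed)
    show "TensM WM (Idn WM X) (Idn WM Y) = Idn WM (TensO WM X Y)"
      using XY by (simp add: WW_monoidal_fields Idn_WW TensM_WW constant_path TensM_Idn)
    fix Z assume "Z \<in> Obj WM"
    then show "TensO WM (TensO WM X Y) Z = TensO WM X (TensO WM Y Z)"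
      using XY by (simp add: WW_monoidal_fields TensO_assoc)
  next
    fix X assume "X \<in> Obj WM"
    then show "TensO WM (UnitO WM) X = X \<and> TensO WM X (UnitO WM) = X"
      by (simp add: WW_monoidal_fields TensO_unit)
  next
    fix A B assume "A \<in> Mor WM" "B \<in> Mor WM"
    then obtain f g where fg: "f \<in> paths C suave" "g \<in> paths C suave" "A = ww f" "B = ww g"
      using WW_MorE unfolding WW_monoidal_fields by metis
    show "TensM WM A B \<in> Mor WM"
      using fg tensor_path(1)[OF fg(1,2)] by (simp add: WW_monoidal_fields TensM_WW Mor_WW)
    show "Tgt WM (TensM WM A B) = TensO WM (Tgt WM A) (Tgt WM B)"
      "Src WM (TensM WM A B) = TensO WM (Src WM A) (Src WM B)"
      using fg by (simp_all add: WW_monoidal_fields TensM_WW WW_ends tensor_path)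
    fix D assume "D \<in> Mor WM"
    then obtain h where h: "h \<in> paths C suave" "D = ww h"
      using WW_MorE unfolding WW_monoidal_fields by metis
    show "TensM WM (TensM WM A B) D = TensM WM A (TensM WM B D)"
      using fg h path_entry(2)
      by (simp add: TensM_WW tensor_path TensM_assoc)
  next
    fix A assume "A \<in> Mor WM"
    then obtain f where f: "f \<in> paths C suave" "A = ww f"
      using WW_MorE unfolding WW_monoidal_fields by metis
    show "TensM WM (Idn WM (UnitO WM)) A = A \<and> TensM WM A (Idn WM (UnitO WM)) = A"
      using f path_entry(2)[OF f(1)]
      by (simp add: WW_monoidal_fields Idn_WW TensM_WW constant_path UnitO_closed TensM_unit)
  next
    fix A B A' B' assume "composable WM A B" "composable WM A' B'"
    then have c: "composable W A B" "composable W A' B'" by (simp_all add: composable_WM)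
    obtain f g n m where 1: "joinable n m f g" "A = ww f" "B = ww g"
      using WW_composableE[OF c(1), of 0 0] .
    obtain f' g' n' m' where 2: "joinable n' m' f' g'" "A' = ww f'" "B' = ww g'"
      using WW_composableE[OF c(2), of 0 0] .
    note j = joinable_common[OF 1(1) 2(1)]
    have p: "f \<in> paths C suave" "g \<in> paths C suave" "f' \<in> paths C suave" "g' \<in> paths C suave"
      using 1 2 by (auto simp only: joinable_def)
    have "concatenate (max n n') (min m m') (tensor f f') (tensor g g') =
        tensor (concatenate (max n n') (min m m') f g) (concatenate (max n n') (min m m') f' g')"
      by (auto simp: concatenate_def fun_eq_iff)
    then show "TensM WM (Cmp WM A B) (Cmp WM A' B') = Cmp WM (TensM WM A A') (TensM WM B B')"
      using concatenate_path(1)[OF j(1)] concatenate_path(1)[OF j(2)] p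
      by (simp add: WW_monoidal_fields 1(2,3) 2(2,3) Cmp_WW[OF j(1)] Cmp_WW[OF j(2)] TensM_WW
          Cmp_WW[OF joinable_tensor[OF j]])
  qed
qed

lemma TensM_WW_single:
  assumes "f \<in> suave" "g \<in> suave"
  shows "TensM WM (ws f) (ws g) = ws (f \<otimes> g)"
proof -
  have "f \<in> Mor C" "g \<in> Mor C" using assms suave_Mor by auto
  then have "tensor (single C f) (single C g) = single C (f \<otimes> g)"
    by (auto simp: single_def fun_eq_iff TensM_Idn Tgt_TensM Src_TensM Tgt_closed Src_closed)
  then show ?thesis
    using TensM_WW single_path(1) assms by (simp add: WW_single_def)
qed

text \<open>
  If composable pairs are congenial, then a composition of classes of single morphisms is again the
  class of a single morphism.
\<close>

lemma monoidal_subcategory_WW_single: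
  assumes M: "subcategory C M" "M \<subseteq> suave"
    and tensor: "\<And>f g. f \<in> M \<Longrightarrow> g \<in> M \<Longrightarrow> f \<otimes> g \<in> M"
    and congenial: "\<And>f g. f \<in> M \<Longrightarrow> g \<in> M \<Longrightarrow> composable C f g \<Longrightarrow> (f, g) \<in> congenial"
  shows "monoidal_subcategory WM (ws ` M)"
proof -
  have s: "f \<in> suave" if "f \<in> M" for f using that M(2) by blast
  have "ws ` M \<subseteq> Mor WM"
    using WW_single(1) s by (auto simp: WW_monoidal_fields)
  moreover have "Idn WM ` Obj WM \<subseteq> ws ` M"
  proof (rule image_subsetI)
    fix X assume "X \<in> Obj WM"
    then have "X \<in> Obj C" by (simp add: WW_monoidal_fields)
    then have "Idn C X \<in> M" "Idn WM X = ws (Idn C X)"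
      using M(1) WW_single_Idn by (auto simp: WW_monoidal_fields subcategory_def)
    then show "Idn WM X \<in> ws ` M" by blast
  qed
  moreover have "Cmp WM (ws f) (ws g) \<in> ws ` M"
    if "f \<in> M" "g \<in> M" "composable WM (ws f) (ws g)" for f g
  proof -
    have "composable C f g"
      using that s S_Mor by (auto simp: composable_def WW_monoidal_fields WW_single)
    then have "(f, g) \<in> congenial" "f \<cdot> g \<in> M"
      using congenial M(1) that by (auto simp: subcategory_def)
    then show ?thesis using WW_single_Cmp by (auto simp: WW_monoidal_fields)
  qed
  moreover have "TensM WM (ws f) (ws g) \<in> ws ` M" if "f \<in> M" "g \<in> M" for f g
    using that tensor TensM_WW_single s by auto
  ultimately show ?thesis
    unfolding monoidal_subcategory_def subcategory_def ball_simps by (intro conjI ballI impI)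
qed

end

lemma (in highly_selective_monoidal_category) monoidal_subcategories_WW:
  "monoidal_subcategory WM (ws ` reductions)" "monoidal_subcategory WM (ws ` coreductions)"
proof -
  show "monoidal_subcategory WM (ws ` reductions)"
    by (rule monoidal_subcategory_WW_single)
      (use reductions_subcategory reductions_suave TensM_reductions
        reduction_coreduction_congenial in blast)+
  show "monoidal_subcategory WM (ws ` coreductions)"
    by (rule monoidal_subcategory_WW_single)
      (use coreductions_subcategory coreductions_suave TensM_coreductions
        reduction_coreduction_congenial in blast)+
qed

section \<open>Duals of morphisms\<close>

context monoidal_category
begin

lemmas monoidal_simps = composable_def UnitO_closed TensO_closed TensO_assoc TensO_unit TensM_closed
  Tgt_TensM Src_TensM Idn_closed Tgt_Idn Src_Idn Cmp_closed Tgt_Cmp Src_Cmp Tgt_closed Src_closed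

lemma TensM_interchange:
  assumes "f \<in> Mor C" "g \<in> Mor C"
  shows "(f \<otimes> Idn C (Tgt C g)) \<cdot> (Idn C (Src C f) \<otimes> g) = f \<otimes> g"
    "(Idn C (Tgt C f) \<otimes> g) \<cdot> (f \<otimes> Idn C (Src C g)) = f \<otimes> g"
  using assms TensM_Cmp[of f "Idn C (Src C f)" "Idn C (Tgt C g)" g]
    TensM_Cmp[of "Idn C (Tgt C f)" f g "Idn C (Src C g)"]
  by (simp_all add: monoidal_simps Idn_left Idn_right)

lemma whisker_Cmp:
  assumes "composable C f g" "X \<in> Obj C"
  shows "(f \<cdot> g) \<otimes> Idn C X = (f \<otimes> Idn C X) \<cdot> (g \<otimes> Idn C X)"
    "Idn C X \<otimes> (f \<cdot> g) = (Idn C X \<otimes> f) \<cdot> (Idn C X \<otimes> g)"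
  using assms TensM_Cmp[of f g "Idn C X" "Idn C X"] TensM_Cmp[of "Idn C X" "Idn C X" f g]
    Idn_left[of "Idn C X"]
  by (simp_all add: monoidal_simps)

lemma whisker_both_Cmp:
  assumes "composable C f g" "X \<in> Obj C" "Y \<in> Obj C"
  shows "Idn C X \<otimes> (f \<cdot> g) \<otimes> Idn C Y = (Idn C X \<otimes> f \<otimes> Idn C Y) \<cdot> (Idn C X \<otimes> g \<otimes> Idn C Y)"
  using assms
  by (subst whisker_Cmp(2), simp, simp, subst whisker_Cmp(1)) (simp_all add: monoidal_simps)

end

context rigid_category
begin

lemma Dual_closed: "X \<in> Obj C \<Longrightarrow> Dual C X \<in> Obj C"
  using left_rigid by (simp add: dual_pair_def)

lemma Coev_arrow: "X \<in> Obj C \<Longrightarrow> \<delta> X \<in> Mor C" "X \<in> Obj C \<Longrightarrow> Tgt C (\<delta> X) = X \<odot> Dual C X"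
    "X \<in> Obj C \<Longrightarrow> Src C (\<delta> X) = \<one>"
  and Ev_arrow: "X \<in> Obj C \<Longrightarrow> \<epsilon> X \<in> Mor C" "X \<in> Obj C \<Longrightarrow> Tgt C (\<epsilon> X) = \<one>"
    "X \<in> Obj C \<Longrightarrow> Src C (\<epsilon> X) = Dual C X \<odot> X"
  using left_rigid by (simp_all add: dual_pair_def)

lemma zigzag:
  assumes "X \<in> Obj C"
  shows "(Idn C X \<otimes> \<epsilon> X) \<cdot> (\<delta> X \<otimes> Idn C X) = Idn C X"
    "(\<epsilon> X \<otimes> Idn C (Dual C X)) \<cdot> (Idn C (Dual C X) \<otimes> \<delta> X) = Idn C (Dual C X)"
  using left_rigid[OF assms] by (simp_all add: dual_pair_def)

lemmas rigid_simps = monoidal_simps Dual_closed Coev_arrow Ev_arrow Dual_Dual Dual_TensO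

lemma DualM_arrow:
  assumes "f \<in> Mor C"
  shows "DualM C f \<in> Mor C" "Tgt C (DualM C f) = Dual C (Src C f)"
    "Src C (DualM C f) = Dual C (Tgt C f)"
  using assms by (simp_all add: DualM_def Let_def rigid_simps)

text \<open>
  In the composition on the left, \<open>\<epsilon> Y\<close> slides past \<open>\<epsilon> X\<close> and \<open>f\<close> until it meets \<open>\<delta> Y\<close>, where a zigzag
  cancels.
\<close>

lemma Ev_DualM:
  assumes f: "f \<in> Mor C"
  shows "\<epsilon> (Src C f) \<cdot> (DualM C f \<otimes> Idn C (Src C f)) = \<epsilon> (Tgt C f) \<cdot> (Idn C (Dual C (Tgt C f)) \<otimes> f)"
proof -
  define X Y where "X = Tgt C f" and "Y = Src C f"
  have XY: "X \<in> Obj C" "Y \<in> Obj C" "Tgt C f = X" "Src C f = Y"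
    using f by (auto simp: X_def Y_def Tgt_closed Src_closed)
  let ?X' = "Idn C (Dual C X)" and ?Y' = "Idn C (Dual C Y)" and ?X = "Idn C X" and ?Y = "Idn C Y"
  have D: "DualM C f \<otimes> ?Y = (\<epsilon> X \<otimes> ?Y' \<otimes> ?Y) \<cdot> (?X' \<otimes> f \<otimes> ?Y' \<otimes> ?Y) \<cdot> (?X' \<otimes> \<delta> Y \<otimes> ?Y)"
    by (simp add: DualM_def Let_def XY whisker_Cmp f rigid_simps)
  have E: "\<epsilon> Y \<cdot> (\<epsilon> X \<otimes> ?Y' \<otimes> ?Y) = \<epsilon> X \<cdot> (?X' \<otimes> ?X \<otimes> \<epsilon> Y)"
    using TensM_interchange[of "\<epsilon> X" "\<epsilon> Y"] XY f
    by (simp add: rigid_simps TensM_unit TensM_assoc flip: TensM_Idn)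
  have F: "(?X' \<otimes> ?X \<otimes> \<epsilon> Y) \<cdot> (?X' \<otimes> f \<otimes> ?Y' \<otimes> ?Y) = (?X' \<otimes> f) \<cdot> (?X' \<otimes> ?Y \<otimes> \<epsilon> Y)"
    using TensM_interchange[of "?X' \<otimes> f" "\<epsilon> Y"] XY f
    by (simp add: rigid_simps TensM_unit TensM_assoc flip: TensM_Idn)
  have G: "(?X' \<otimes> ?Y \<otimes> \<epsilon> Y) \<cdot> (?X' \<otimes> \<delta> Y \<otimes> ?Y) = ?X' \<otimes> ?Y"
    using whisker_Cmp(2)[of "?Y \<otimes> \<epsilon> Y" "\<delta> Y \<otimes> ?Y" "Dual C X", symmetric] zigzag(1)[of Y] XY f
    by (simp add: rigid_simps TensM_assoc)
  have "\<epsilon> Y \<cdot> (DualM C f \<otimes> ?Y) =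
      \<epsilon> Y \<cdot> (\<epsilon> X \<otimes> ?Y' \<otimes> ?Y) \<cdot> (?X' \<otimes> f \<otimes> ?Y' \<otimes> ?Y) \<cdot> (?X' \<otimes> \<delta> Y \<otimes> ?Y)"
    unfolding D using XY f by (simp add: rigid_simps Cmp_assoc)
  also have "\<dots> = \<epsilon> X \<cdot> ((?X' \<otimes> ?X \<otimes> \<epsilon> Y) \<cdot> (?X' \<otimes> f \<otimes> ?Y' \<otimes> ?Y)) \<cdot> (?X' \<otimes> \<delta> Y \<otimes> ?Y)"
    unfolding E using XY f by (simp add: rigid_simps Cmp_assoc)
  also have "\<dots> = \<epsilon> X \<cdot> (?X' \<otimes> f) \<cdot> ((?X' \<otimes> ?Y \<otimes> \<epsilon> Y) \<cdot> (?X' \<otimes> \<delta> Y \<otimes> ?Y))"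
    unfolding F using XY f by (simp add: rigid_simps Cmp_assoc)
  also have "\<dots> = \<epsilon> X \<cdot> (?X' \<otimes> f)"
    unfolding G using XY f Idn_right[of "?X' \<otimes> f"] by (simp add: rigid_simps Cmp_assoc TensM_Idn)
  finally show ?thesis using XY by simp
qed

text \<open>
  A zigzag inserted after \<open>g\<close> expresses \<open>g\<close> in terms of the left side of the equation, and
  replacing it by the right side gives the definition of the dual of \<open>f\<close>.
\<close>

lemma DualM_unique:
  assumes f: "f \<in> Mor C" and g: "g \<in> Mor C"
    and ends: "Tgt C g = Dual C (Src C f)" "Src C g = Dual C (Tgt C f)"
    and eq: "\<epsilon> (Src C f) \<cdot> (g \<otimes> Idn C (Src C f)) = \<epsilon> (Tgt C f) \<cdot> (Idn C (Dual C (Tgt C f)) \<otimes> f)"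
  shows "g = DualM C f"
proof -
  define X Y where "X = Tgt C f" and "Y = Src C f"
  have XY: "X \<in> Obj C" "Y \<in> Obj C" "Tgt C f = X" "Src C f = Y"
    using f by (auto simp: X_def Y_def Tgt_closed Src_closed)
  let ?X' = "Idn C (Dual C X)" and ?Y' = "Idn C (Dual C Y)" and ?Y = "Idn C Y"
  note g' = g ends[unfolded XY]
  have G: "(?Y' \<otimes> \<delta> Y) \<cdot> g = (g \<otimes> ?Y \<otimes> ?Y') \<cdot> (?X' \<otimes> \<delta> Y)"
    using TensM_interchange[of g "\<delta> Y"] XY g'
    by (simp add: rigid_simps TensM_unit TensM_assoc flip: TensM_Idn)
  have "g = (\<epsilon> Y \<otimes> ?Y') \<cdot> (?Y' \<otimes> \<delta> Y) \<cdot> g"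
    using zigzag(2)[of Y] XY g' Idn_left[of g] by simp
  also have "\<dots> = (\<epsilon> Y \<otimes> ?Y') \<cdot> (g \<otimes> ?Y \<otimes> ?Y') \<cdot> (?X' \<otimes> \<delta> Y)"
    using G XY g' by (simp add: rigid_simps Cmp_assoc)
  also have "(\<epsilon> Y \<otimes> ?Y') \<cdot> (g \<otimes> ?Y \<otimes> ?Y') = (\<epsilon> Y \<cdot> (g \<otimes> ?Y)) \<otimes> ?Y'"
    using XY g' by (simp add: whisker_Cmp rigid_simps)
  also have "\<dots> = (\<epsilon> X \<cdot> (?X' \<otimes> f)) \<otimes> ?Y'" using eq XY by simp
  also have "\<dots> = (\<epsilon> X \<otimes> ?Y') \<cdot> (?X' \<otimes> f \<otimes> ?Y')"
    using XY f by (simp add: whisker_Cmp rigid_simps)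
  finally show ?thesis by (simp add: DualM_def Let_def XY)
qed

lemma DualM_Idn: "X \<in> Obj C \<Longrightarrow> DualM C (Idn C X) = Idn C (Dual C X)"
  by (rule DualM_unique[symmetric]) (simp_all add: rigid_simps)

text \<open>
  The dual of \<open>g\<close>, and then that of \<open>f\<close>, is carried across the counit by \<open>Ev_DualM\<close>.
\<close>

lemma DualM_Cmp:
  assumes c: "composable C f g"
  shows "DualM C (f \<cdot> g) = DualM C g \<cdot> DualM C f"
proof -
  define X Y Z where "X = Tgt C f" and "Y = Src C f" and "Z = Src C g"
  have f: "f \<in> Mor C" and g: "g \<in> Mor C" and O: "X \<in> Obj C" "Y \<in> Obj C" "Z \<in> Obj C"
    and ends: "Tgt C f = X" "Src C f = Y" "Tgt C g = Y" "Src C g = Z"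
    using c by (auto simp: X_def Y_def Z_def composable_def Tgt_closed Src_closed)
  let ?X' = "Idn C (Dual C X)" and ?Y' = "Idn C (Dual C Y)" and ?Y = "Idn C Y" and ?Z = "Idn C Z"
  let ?f' = "DualM C f" and ?g' = "DualM C g"
  note arrows = f g O ends DualM_arrow[OF f] DualM_arrow[OF g]
  have I: "(?Y' \<otimes> g) \<cdot> (?f' \<otimes> ?Z) = (?f' \<otimes> ?Y) \<cdot> (?X' \<otimes> g)"
    using TensM_interchange[of ?f' g] arrows by simp
  have E: "\<epsilon> Z \<cdot> (?g' \<otimes> ?Z) = \<epsilon> Y \<cdot> (?Y' \<otimes> g)" "\<epsilon> Y \<cdot> (?f' \<otimes> ?Y) = \<epsilon> X \<cdot> (?X' \<otimes> f)"
    using Ev_DualM[OF g] Ev_DualM[OF f] ends by simp_all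
  have "\<epsilon> Z \<cdot> ((?g' \<cdot> ?f') \<otimes> ?Z) = \<epsilon> Z \<cdot> (?g' \<otimes> ?Z) \<cdot> (?f' \<otimes> ?Z)"
    using arrows by (simp add: whisker_Cmp rigid_simps Cmp_assoc)
  also have "\<dots> = \<epsilon> Y \<cdot> ((?Y' \<otimes> g) \<cdot> (?f' \<otimes> ?Z))"
    unfolding E using arrows by (simp add: rigid_simps Cmp_assoc)
  also have "\<dots> = \<epsilon> Y \<cdot> (?f' \<otimes> ?Y) \<cdot> (?X' \<otimes> g)"
    unfolding I using arrows by (simp add: rigid_simps Cmp_assoc)
  also have "\<dots> = \<epsilon> X \<cdot> (?X' \<otimes> (f \<cdot> g))"
    unfolding E using arrows by (simp add: whisker_Cmp rigid_simps Cmp_assoc)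
  finally show ?thesis
    using arrows by (intro DualM_unique[symmetric]) (simp_all add: rigid_simps)
qed

lemma Dual_UnitO: "Dual C \<one> = \<one>"
proof -
  have "\<one> \<odot> Dual C \<one> = \<one>"
    using Dual_TensO[of \<one> "Dual C \<one>"] by (simp add: rigid_simps)
  then show ?thesis by (simp add: rigid_simps)
qed

end

locale coherent_rigid_category = rigid_category +
  assumes coherent: "coherent_duality C"
begin

lemma DualM_DualM: "f \<in> Mor C \<Longrightarrow> DualM C (DualM C f) = f"
  using coherent by (simp add: coherent_duality_def)

lemma Coev_TensO: "X \<in> Obj C \<Longrightarrow> Y \<in> Obj C \<Longrightarrow>
    \<delta> (X \<odot> Y) = (Idn C X \<otimes> \<delta> Y \<otimes> Idn C (Dual C X)) \<cdot> \<delta> X"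
  and Ev_TensO: "X \<in> Obj C \<Longrightarrow> Y \<in> Obj C \<Longrightarrow>
    \<epsilon> (X \<odot> Y) = \<epsilon> Y \<cdot> (Idn C (Dual C Y) \<otimes> \<epsilon> X \<otimes> Idn C Y)"
  using coherent by (simp_all add: coherent_duality_def)

text \<open>
  Coherence for \<open>\<one> \<odot> \<one> = \<one>\<close> makes the counit of \<open>\<one>\<close> idempotent, and the zigzag makes it a split
  epimorphism.
\<close>

lemma Ev_UnitO: "\<epsilon> \<one> = Idn C \<one>"
proof -
  note U = UnitO_closed Dual_UnitO
  have idem: "\<epsilon> \<one> \<cdot> \<epsilon> \<one> = \<epsilon> \<one>"
    using Ev_TensO[of \<one> \<one>] by (simp add: U rigid_simps TensM_unit)
  have inv: "\<epsilon> \<one> \<cdot> \<delta> \<one> = Idn C \<one>"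
    using zigzag(1)[of \<one>] by (simp add: U rigid_simps TensM_unit)
  have "\<epsilon> \<one> = \<epsilon> \<one> \<cdot> (\<epsilon> \<one> \<cdot> \<delta> \<one>)"
    unfolding inv using Idn_right[of "\<epsilon> \<one>"] by (simp add: U rigid_simps)
  also have "\<dots> = \<epsilon> \<one> \<cdot> \<epsilon> \<one> \<cdot> \<delta> \<one>"
    by (rule Cmp_assoc[symmetric]) (simp_all add: U rigid_simps)
  finally show ?thesis unfolding idem inv .
qed

text \<open>
  The counit of \<open>Y \<odot> Z\<close> is nested, with that of \<open>Y\<close> inside, so that the equation characterizing the
  dual of \<open>f\<close> can be applied inside the counit of \<open>Z\<close>.
\<close>

lemma DualM_TensM_Idn:
  assumes f: "f \<in> Mor C" and Z: "Z \<in> Obj C"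
  shows "DualM C (f \<otimes> Idn C Z) = Idn C (Dual C Z) \<otimes> DualM C f"
proof -
  define X Y where "X = Tgt C f" and "Y = Src C f"
  have XY: "X \<in> Obj C" "Y \<in> Obj C" "Tgt C f = X" "Src C f = Y"
    using f by (auto simp: X_def Y_def Tgt_closed Src_closed)
  let ?X' = "Idn C (Dual C X)" and ?Z' = "Idn C (Dual C Z)" and ?Y = "Idn C Y" and ?Z = "Idn C Z"
  let ?f' = "DualM C f"
  note arrows = f Z XY DualM_arrow[OF f]
  have "\<epsilon> (Y \<odot> Z) \<cdot> (?Z' \<otimes> ?f' \<otimes> Idn C (Y \<odot> Z)) =
      \<epsilon> Z \<cdot> ((?Z' \<otimes> \<epsilon> Y \<otimes> ?Z) \<cdot> (?Z' \<otimes> (?f' \<otimes> ?Y) \<otimes> ?Z))"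
    using arrows by (simp add: Ev_TensO rigid_simps Cmp_assoc TensM_assoc flip: TensM_Idn)
  also have "(?Z' \<otimes> \<epsilon> Y \<otimes> ?Z) \<cdot> (?Z' \<otimes> (?f' \<otimes> ?Y) \<otimes> ?Z) = ?Z' \<otimes> (\<epsilon> X \<cdot> (?X' \<otimes> f)) \<otimes> ?Z"
    using arrows whisker_both_Cmp[of "\<epsilon> Y" "?f' \<otimes> ?Y" "Dual C Z" Z] Ev_DualM[OF f]
    by (simp add: rigid_simps)
  also have "\<dots> = (?Z' \<otimes> \<epsilon> X \<otimes> ?Z) \<cdot> (?Z' \<otimes> (?X' \<otimes> f) \<otimes> ?Z)"
    using arrows by (intro whisker_both_Cmp) (simp_all add: rigid_simps)
  also have "\<epsilon> Z \<cdot> \<dots> = \<epsilon> (X \<odot> Z) \<cdot> (Idn C (Dual C (X \<odot> Z)) \<otimes> (f \<otimes> ?Z))"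
    using arrows by (simp add: Ev_TensO rigid_simps Cmp_assoc TensM_assoc flip: TensM_Idn)
  finally show ?thesis
    using arrows by (intro DualM_unique[symmetric]) (simp_all add: rigid_simps)
qed

text \<open>
  The counit of \<open>Dual C X \<odot> X\<close> is \<open>\<epsilon> X\<close> wrapped around that of \<open>Dual C X\<close>, and the latter cancels
  against \<open>\<delta> (Dual C X)\<close>.
\<close>

lemma DualM_Coev:
  assumes X: "X \<in> Obj C"
  shows "DualM C (\<delta> (Dual C X)) = \<epsilon> X"
proof -
  let ?X' = "Idn C (Dual C X)" and ?X = "Idn C X"
  have Z: "(?X' \<otimes> \<epsilon> (Dual C X) \<otimes> ?X) \<cdot> (?X' \<otimes> ?X \<otimes> \<delta> (Dual C X)) = ?X' \<otimes> ?X"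
    using zigzag(2)[of "Dual C X"] X
      whisker_Cmp(2)[of "\<epsilon> (Dual C X) \<otimes> ?X" "?X \<otimes> \<delta> (Dual C X)" "Dual C X", symmetric]
    by (simp add: rigid_simps TensM_assoc)
  have "\<epsilon> (Dual C X \<odot> X) \<cdot> (Idn C (Dual C X \<odot> X) \<otimes> \<delta> (Dual C X)) =
      \<epsilon> X \<cdot> ((?X' \<otimes> \<epsilon> (Dual C X) \<otimes> ?X) \<cdot> (?X' \<otimes> ?X \<otimes> \<delta> (Dual C X)))"
    using X by (simp add: Ev_TensO rigid_simps Cmp_assoc flip: TensM_Idn)
  also have "\<dots> = \<epsilon> X"
    unfolding Z using X Idn_right[of "\<epsilon> X"] by (simp add: rigid_simps TensM_Idn)
  finally have "\<epsilon> \<one> \<cdot> (\<epsilon> X \<otimes> Idn C \<one>) =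
      \<epsilon> (Dual C X \<odot> X) \<cdot> (Idn C (Dual C X \<odot> X) \<otimes> \<delta> (Dual C X))"
    using X Idn_left[of "\<epsilon> X"] by (simp add: Ev_UnitO rigid_simps TensM_unit)
  then show ?thesis
    using X by (intro DualM_unique[symmetric]) (simp_all add: rigid_simps Dual_UnitO)
qed

end

section \<open>The rigid structure\<close>

context selective_rigid_category
begin

abbreviation "WR \<equiv> WW_rigid C suave congenial"

lemma truncate_WW_rigid: "mcat.truncate WR = WM"
  by (simp add: WW_rigid_def mcat.defs)

lemma WW_rigid_fields:
  "Obj WR = Obj C" "Mor WR = Mor W" "Tgt WR = Tgt W" "Src WR = Src W" "Idn WR = Idn W"
  "Cmp WR = Cmp W" "TensO WR = TensO C" "UnitO WR = UnitO C" "TensM WR = TensM WM"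
  "Dual WR = Dual C" "Coev WR X = ws (\<delta> X)" "Ev WR X = ws (\<epsilon> X)"
  by (simp_all add: WW_rigid_def mcat.defs rcat.defs WW_monoidal_fields)

text \<open>
  Both are instances, with \<open>f = \<epsilon> X\<close>, of the axioms on turning a suave morphism with a unit.
\<close>

lemma zigzag_congenial:
  assumes X: "X \<in> Obj C"
  shows "(Idn C X \<otimes> \<epsilon> X, \<delta> X \<otimes> Idn C X) \<in> congenial"
    "(\<epsilon> X \<otimes> Idn C (Dual C X), Idn C (Dual C X) \<otimes> \<delta> X) \<in> congenial"
  using Coev_congenial_left[of "Dual C X" X "\<epsilon> X"] Coev_congenial_right[of "Dual C X" X "\<epsilon> X"] X
  by (simp_all add: rigid_simps Ev_suave)

lemma WW_single_TensM_Idn: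
  assumes "f \<in> suave" "X \<in> Obj C"
  shows "TensM WM (ws f) (Idn W X) = ws (f \<otimes> Idn C X)"
    "TensM WM (Idn W X) (ws f) = ws (Idn C X \<otimes> f)"
  using assms TensM_WW_single[of f "Idn C X"] TensM_WW_single[of "Idn C X" f]
  by (simp_all add: Idn_suave WW_single_Idn)

lemma dual_pair_WW:
  assumes X: "X \<in> Obj C"
  shows "dual_pair WR X (Dual C X) (ws (\<delta> X)) (ws (\<epsilon> X))"
  unfolding dual_pair_def WW_rigid_fields
  using X Coev_suave[OF X] Ev_suave[OF X] zigzag[OF X]
  by (simp add: Dual_closed WW_single Coev_arrow Ev_arrow WW_single_TensM_Idn
      WW_single_Cmp[OF zigzag_congenial(1)] WW_single_Cmp[OF zigzag_congenial(2)] WW_single_Idn)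

theorem rigid_category_WW: "rigid_category WR"
proof (rule rigid_category.intro)
  show "monoidal_category WR"
    using monoidal_category_WW monoidal_category_truncate truncate_WW_rigid by metis
  show "rigid_category_axioms WR"
    by unfold_locales
      (use dual_pair_WW dual_pair_WW[OF Dual_closed] Dual_Dual Dual_TensO in
        \<open>simp_all add: WW_rigid_fields\<close>)
qed

end

locale coherent_selective_rigid_category =
  selective_rigid_category C suave congenial + coherent_rigid_category C
  for C :: "('o, 'm, 'z) rcat_scheme" (structure) and suave congenial
begin

text \<open>
  Selectivity of duality is a statement on pairs, and \<open>f\<close> forms a congenial pair with an identity.
\<close>

lemma DualM_suave:
  assumes f: "f \<in> suave" 
  shows "DualM C f \<in> suave"
proof -
  have M: "f \<in> Mor C" using f suave_Mor by blast
  have "(f, Idn C (Src C f)) \<in> congenial"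
    using f M by (intro Idn_congenial) (auto simp: Idn_suave rigid_simps)
  then show ?thesis using DualM_selective congenialD by blast
qed

text \<open>
  The axioms give congenial pairs only with units. This is the counterpart for counits: it is the dual
  of the congeniality of \<open>(DualM C f \<otimes> 1, \<delta> (Dual C X))\<close>.
\<close>

lemma Ev_congenial:
  assumes f: "f \<in> suave" and X: "Tgt C f = X"
  shows "(\<epsilon> X, Idn C (Dual C X) \<otimes> f) \<in> congenial"
proof -
  have M: "f \<in> Mor C" using f suave_Mor by blast
  have O: "X \<in> Obj C" using M X Tgt_closed by blast
  have "(DualM C f \<otimes> Idn C X, \<delta> (Dual C X)) \<in> congenial"
    using Coev_congenial_right[of \<one> "Dual C X" "DualM C f"] DualM_suave[OF f] O X DualM_arrow[OF M]
    by (simp add: rigid_simps TensM_unit)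
  then have "(DualM C (\<delta> (Dual C X)), DualM C (DualM C f \<otimes> Idn C X)) \<in> congenial"
    by (rule DualM_selective)
  then show ?thesis
    using O M DualM_arrow[OF M] by (simp add: DualM_Coev DualM_TensM_Idn DualM_DualM)
qed

text \<open>
  The first two of the three morphisms whose composition is the dual of \<open>f\<close> are contracted by
  \<open>Ev_congenial\<close>; the result is a suave morphism tensored with an identity, so that the axiom on units
  allows contraction with the third.
\<close>

lemma DualM_WW_single:
  assumes f: "f \<in> suave"
  shows "DualM WR (ws f) = ws (DualM C f)"
proof -
  have M: "f \<in> Mor C" using f suave_Mor by blast
  define X Y where "X = Tgt C f" and "Y = Src C f"
  have XY: "X \<in> Obj C" "Y \<in> Obj C" "Tgt C f = X" "Src C f = Y"
    using M by (auto simp: X_def Y_def Tgt_closed Src_closed)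
  let ?X' = "Idn C (Dual C X)" and ?Y' = "Idn C (Dual C Y)"
  have 1: "(\<epsilon> X, ?X' \<otimes> f) \<in> congenial" by (rule Ev_congenial[OF f XY(3)])
  have I: "(?Y', ?Y') \<in> congenial"
    using XY by (intro Idn_congenial) (auto simp: Idn_suave rigid_simps)
  have 2: "(\<epsilon> X \<otimes> ?Y', ?X' \<otimes> f \<otimes> ?Y') \<in> congenial" by (rule TensM_congenial[OF 1 I])
  have E: "(\<epsilon> X \<otimes> ?Y') \<cdot> (?X' \<otimes> f \<otimes> ?Y') = (\<epsilon> X \<cdot> (?X' \<otimes> f)) \<otimes> ?Y'"
    using XY M by (simp add: whisker_Cmp rigid_simps)
  have 3: "((\<epsilon> X \<otimes> ?Y') \<cdot> (?X' \<otimes> f \<otimes> ?Y'), ?X' \<otimes> \<delta> Y) \<in> congenial"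
    unfolding E using XY M Cmp_suave[OF 1]
    by (intro Coev_congenial_right) (simp_all add: rigid_simps)
  have s: "?X' \<otimes> f \<in> suave" using f XY by (intro TensM_suave) (simp_all add: Idn_suave Dual_closed)
  show ?thesis
    using XY f s
    by (simp add: DualM_def Let_def WW_rigid_fields WW_single WW_single_TensM_Idn Ev_suave Coev_suave
        Dual_closed WW_single_Cmp[OF 2] WW_single_Cmp[OF 3])
qed

text \<open>
  Double duals are the identity on classes of suave morphisms and hence on their compositions. For
  the formulas for \<open>\<delta> (X \<odot> Y)\<close> and \<open>\<epsilon> (X \<odot> Y)\<close> it is enough that the pairs on the right are
  congenial, the second being an instance of \<open>Ev_congenial\<close> for \<open>f = \<epsilon> X \<otimes> 1\<close>.
\<close>

theorem coherent_duality_WW: "coherent_duality WR"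
proof -
  interpret WR: rigid_category WR by (rule rigid_category_WW)
  have double: "DualM WR (DualM WR A) = A" if "A \<in> Mor W" for A
    using that
  proof (induction A rule: WW_induct)
    case (Idn X)
    then show ?case
      using WR.DualM_Idn[of X] WR.DualM_Idn[of "Dual C X"]
      by (simp add: WW_rigid_fields Dual_closed Dual_Dual)
  next
    case (Cmp f B)
    have f: "DualM WR (DualM WR (ws f)) = ws f"
      using Cmp(1) suave_Mor by (auto simp: DualM_WW_single DualM_suave DualM_DualM)
    have c: "composable WR (ws f) B"
      using Cmp(2) by (simp add: composable_def WW_rigid_fields)
    then have "composable WR (DualM WR B) (DualM WR (ws f))"
      using WR.DualM_arrow by (simp add: composable_def)
    then have "DualM WR (DualM WR (Cmp WR (ws f) B)) = Cmp WR (ws f) B"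
      using WR.DualM_Cmp[OF c] WR.DualM_Cmp f Cmp(3) by simp
    then show ?case by (simp add: WW_rigid_fields)
  qed
  have Coev: "ws (\<delta> (X \<odot> Y)) =
      Cmp W (TensM WM (TensM WM (Idn W X) (ws (\<delta> Y))) (Idn W (Dual C X))) (ws (\<delta> X))"
    if X: "X \<in> Obj C" and Y: "Y \<in> Obj C" for X Y
  proof -
    have s: "Idn C X \<otimes> \<delta> Y \<in> suave" using X Y by (simp add: TensM_suave Idn_suave Coev_suave)
    have "(Idn C X \<otimes> \<delta> Y \<otimes> Idn C (Dual C X), \<delta> X) \<in> congenial"
      using Coev_congenial_right[of \<one> X "Idn C X \<otimes> \<delta> Y"] s X Y
      by (simp add: rigid_simps TensM_unit)
    from WW_single_Cmp[OF this] show ?thesis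
      using s X Y by (simp add: WW_single_TensM_Idn Dual_closed Coev_suave Coev_TensO)
  qed
  have Ev: "ws (\<epsilon> (X \<odot> Y)) =
      Cmp W (ws (\<epsilon> Y)) (TensM WM (TensM WM (Idn W (Dual C Y)) (ws (\<epsilon> X))) (Idn W Y))"
    if X: "X \<in> Obj C" and Y: "Y \<in> Obj C" for X Y
  proof -
    have s: "Idn C (Dual C Y) \<otimes> \<epsilon> X \<in> suave" "\<epsilon> X \<otimes> Idn C Y \<in> suave"
      using X Y by (simp_all add: TensM_suave Idn_suave Ev_suave Dual_closed)
    have "(\<epsilon> Y, Idn C (Dual C Y) \<otimes> \<epsilon> X \<otimes> Idn C Y) \<in> congenial"
      using Ev_congenial[OF s(2), of Y] X Y by (simp add: rigid_simps TensM_assoc)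
    from WW_single_Cmp[OF this] show ?thesis
      using s X Y by (simp add: WW_single_TensM_Idn Dual_closed Ev_suave Ev_TensO)
  qed
  show ?thesis
    unfolding coherent_duality_def WW_rigid_fields by (intro conjI ballI double Coev Ev)
qed

end

lemma (in highly_selective_rigid_category) monoidal_subcategories_WW_rigid:
  "monoidal_subcategory (WW_rigid C suave congenial) (ws ` reductions)"
  "monoidal_subcategory (WW_rigid C suave congenial) (ws ` coreductions)"
  using monoidal_subcategories_WW
  unfolding monoidal_subcategory_def subcategory_def composable_def
  by (simp_all add: WW_rigid_fields WW_monoidal_fields)

theorem theorem4p15:
  fixes C :: "('o, 'm) mcat" and D :: "('p, 'n) rcat"
  shows
    "(\<forall>suave congenial.
        selective_monoidal_category C suave congenial \<longrightarrow>
        monoidal_category (WW_monoidal C suave congenial)) \<and>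
     (\<forall>suave congenial.
        selective_rigid_category D suave congenial \<longrightarrow>
        rigid_category (WW_rigid D suave congenial) \<and>
        (coherent_duality D \<longrightarrow> coherent_duality (WW_rigid D suave congenial))) \<and>
     (\<forall>suave congenial reductions coreductions.
        highly_selective_monoidal_category C suave congenial reductions coreductions \<longrightarrow>
        monoidal_subcategory (WW_monoidal C suave congenial)
          (WW_single C suave congenial ` reductions) \<and>
        monoidal_subcategory (WW_monoidal C suave congenial)
          (WW_single C suave congenial ` coreductions)) \<and>
     (\<forall>suave congenial reductions coreductions.
        highly_selective_rigid_category D suave congenial reductions coreductions \<longrightarrow>
        monoidal_subcategory (WW_rigid D suave congenial)
          (WW_single D suave congenial ` reductions) \<and>
        monoidal_subcategory (WW_rigid D suave congenial)
          (WW_single D suave congenial ` coreductions))"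
proof (intro conjI allI impI)
  fix suave congenial
  assume "selective_monoidal_category C suave congenial"
  then show "monoidal_category (WW_monoidal C suave congenial)"
    by (rule selective_monoidal_category.monoidal_category_WW)
next
  fix suave congenial
  assume D: "selective_rigid_category D suave congenial"
  then show "rigid_category (WW_rigid D suave congenial)"
    by (rule selective_rigid_category.rigid_category_WW)
  assume "coherent_duality D"
  then have "coherent_selective_rigid_category D suave congenial"
    using D by (simp add: coherent_selective_rigid_category_def coherent_rigid_category_def
        coherent_rigid_category_axioms_def selective_rigid_category_def)
  then show "coherent_duality (WW_rigid D suave congenial)"
    by (rule coherent_selective_rigid_category.coherent_duality_WW)
next
  fix suave congenial reductions coreductions
  assume "highly_selective_monoidal_category C suave congenial reductions coreductions"
  note * = highly_selective_monoidal_category.monoidal_subcategories_WW[OF this]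
  show "monoidal_subcategory (WW_monoidal C suave congenial)
      (WW_single C suave congenial ` reductions)" by (rule *)
  show "monoidal_subcategory (WW_monoidal C suave congenial)
      (WW_single C suave congenial ` coreductions)" by (rule *)
next
  fix suave congenial reductions coreductions
  assume "highly_selective_rigid_category D suave congenial reductions coreductions"
  note * = highly_selective_rigid_category.monoidal_subcategories_WW_rigid[OF this]
  show "monoidal_subcategory (WW_rigid D suave congenial)
      (WW_single D suave congenial ` reductions)" by (rule *)
  show "monoidal_subcategory (WW_rigid D suave congenial)
      (WW_single D suave congenial ` coreductions)" by (rule *)
qed

end
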